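(* Let $R=\mathbb{C}[x,y,z,w]$ and let $I_3\subseteq R$ be the ideal generated by $$(x^3-y^3)(z^3-w^3)xy,\ (x^3-y^3)(z^3-w^3)zw,\ (x^3-z^3)(y^3-w^3)xz,\ (x^3-z^3)(y^3-w^3)yw,\ (x^3-w^3)(y^3-z^3)xw,\ (x^3-w^3)(y^3-z^3)yz.$$ Then (1) $\alpha(I_3^{(3m)})=18m$ for all $m\ge 1$; (2) $\alpha(I_3^{(3m+1)})=18m+8$ for all $m\ge 0$; (3) $\alpha(I_3^{(3m+2)})=18m+16$ for all $m\ge 0$.
   Context: For a homogeneous ideal $I$, $\alpha(I)$ denotes the least degree of a nonzero homogeneous element of $I$. The $m$-th symbolic power is $I^{(m)}=\bigcap_{\mathfrak p\in \operatorname{Ass}(R/I)} (I^mR_{\mathfrak p}\cap R)$, with $I^{(1)}=I$. *)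

theory Defs
  imports Complex_Main "HOL-Library.Poly_Mapping"
begin

datatype var = X | Y | Z | W

text \<open>Monomials are finitely supported exponent vectors var =>0 nat; polynomials are
finitely supported coefficient functions on monomials (convolution product).\<close>
type_synonym R = "(var \<Rightarrow>\<^sub>0 nat) \<Rightarrow>\<^sub>0 complex"

definition Var :: "var \<Rightarrow> R" where
  "Var v = Poly_Mapping.single (Poly_Mapping.single v 1) 1"

definition mon_deg :: "(var \<Rightarrow>\<^sub>0 nat) \<Rightarrow> nat" where
  "mon_deg m = (\<Sum>v\<in>Poly_Mapping.keys m. Poly_Mapping.lookup m v)"

definition homogeneous_of_degree :: "nat \<Rightarrow> R \<Rightarrow> bool" where
  "homogeneous_of_degree d f \<longleftrightarrow> (\<forall>m\<in>Poly_Mapping.keys f. mon_deg m = d)"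

definition is_ideal :: "'a::comm_ring_1 set \<Rightarrow> bool" where
  "is_ideal I \<longleftrightarrow> 0 \<in> I \<and> (\<forall>a\<in>I. \<forall>b\<in>I. a + b \<in> I) \<and> (\<forall>r. \<forall>a\<in>I. r * a \<in> I)"

definition ideal_gen :: "'a::comm_ring_1 set \<Rightarrow> 'a set" where
  "ideal_gen S = \<Inter>{J. is_ideal J \<and> S \<subseteq> J}"

definition ideal_power :: "'a::comm_ring_1 set \<Rightarrow> nat \<Rightarrow> 'a set" where
  "ideal_power I m = ideal_gen {prod_list xs | xs. length xs = m \<and> set xs \<subseteq> I}"

definition is_prime_ideal :: "'a::comm_ring_1 set \<Rightarrow> bool" where
  "is_prime_ideal P \<longleftrightarrow> is_ideal P \<and> P \<noteq> UNIV \<and> (\<forall>a b. a * b \<in> P \<longrightarrow> a \<in> P \<or> b \<in> P)"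

definition ideal_colon :: "'a::comm_ring_1 set \<Rightarrow> 'a \<Rightarrow> 'a set" where
  "ideal_colon I f = {r. r * f \<in> I}"

definition Ass :: "'a::comm_ring_1 set \<Rightarrow> 'a set set" where
  "Ass I = {P. is_prime_ideal P \<and> (\<exists>f. P = ideal_colon I f)}"

text \<open>Contraction of the localization: J R_P \<inter> R = {f. \<exists>s\<notin>P. s f \<in> J}.\<close>
definition loc_contract :: "'a::comm_ring_1 set \<Rightarrow> 'a set \<Rightarrow> 'a set" where
  "loc_contract J P = {f. \<exists>s. s \<notin> P \<and> s * f \<in> J}"

definition symbolic_power :: "'a::comm_ring_1 set \<Rightarrow> nat \<Rightarrow> 'a set" where
  "symbolic_power I m = (\<Inter>P\<in>Ass I. loc_contract (ideal_power I m) P)"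

definition alpha :: "R set \<Rightarrow> nat" where
  "alpha I = (LEAST d. \<exists>f\<in>I. f \<noteq> 0 \<and> homogeneous_of_degree d f)"

definition I3 :: "R set" where
  "I3 = (let x = Var X; y = Var Y; z = Var Z; w = Var W in
     ideal_gen {(x^3 - y^3) * (z^3 - w^3) * x * y,
                (x^3 - y^3) * (z^3 - w^3) * z * w,
                (x^3 - z^3) * (y^3 - w^3) * x * z,
                (x^3 - z^3) * (y^3 - w^3) * y * w,
                (x^3 - w^3) * (y^3 - z^3) * x * w,
                (x^3 - w^3) * (y^3 - z^3) * y * z})"

end

(*
Let F (below: fermat) be the product of the six forms u^3
    - v^3 over pairs of variables; it has degree 18 and factors
into 18 planes u = w v with w^3 = 1. The ideal I3 vanishes on 42 lines: the six coordinate lines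
a = b = 0 and the 36 lines q = e p, r = e' p with e^3 = e'^3 = 1. Exactly three of the planes pass
through each line, so F has order exactly 3 along it.

Lower bound. Each line ideal P is a colon ideal I3 : h, so it is associated, and a form f of
    degree d
in the n-th symbolic power has order at least n along each line. If d < 8 n, then f vanishes on each
of the planes u = w v: a general line in that plane through its point on the opposite coordinate
    line
meets eight of the 42 lines, in distinct points. Hence F divides f, and f / F has order at least n
    - 3 along each line; induct on n.

Upper bound. The powers F^m g^j, with g a generator, have the right degree, so it suffices that
    every
associated prime P = I3 : h admits t outside P with t F in I3^3. Otherwise explicit choices of t
    force
three of the variables into P. With A and B as in quad1 and quad2, I3 is the set of all A u
    + B v with
u, v subject to vanishing conditions on the six coordinate planes of C^4; a nonzerodivisor argument
modulo (A, B) then shows that h is in I3, a contradiction.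
*)
theory Submission
  imports Defs "HOL-Computational_Algebra.Polynomial"
begin

section \<open>Evaluation and substitution\<close>

lemma UNIV_var: "(UNIV :: var set) = {X, Y, Z, W}"
  using var.exhaust by blast

instance var :: finite
proof
  show "finite (UNIV :: var set)" unfolding UNIV_var by simp
qed

text \<open>Any linear order on the variables will do; it makes the polynomials an integral domain.\<close>

instantiation var :: linorder
begin

definition less_eq_var :: "var \<Rightarrow> var \<Rightarrow> bool" where
  "less_eq_var u v \<longleftrightarrow> (case_var 0 1 2 3 u :: nat) \<le> case_var 0 1 2 3 v"

definition less_var :: "var \<Rightarrow> var \<Rightarrow> bool" where
  "less_var u v \<longleftrightarrow> (case_var 0 1 2 3 u :: nat) < case_var 0 1 2 3 v"

instance
  by standard (auto simp: less_eq_var_def less_var_def split: var.splits)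

end

section \<open>Ring homomorphisms out of \<open>R\<close> and evaluation at points\<close>

definition Const :: "complex \<Rightarrow> R" where
  "Const c = Poly_Mapping.single 0 c"

lemma Const_simps [simp]:
  "Const 0 = 0" "Const 1 = 1" "Const (a + b) = Const a + Const b"
  "Const (a * b) = Const a * Const b" "Const (- a) = - Const a" "Const (a - b) = Const a - Const b"
  by (simp_all add: Const_def single_add mult_single single_uminus single_diff)

lemma Const_power [simp]: "Const (a ^ n) = Const a ^ n"
  by (induction n) auto

lemma Const_eq_0_iff [simp]: "Const a = 0 \<longleftrightarrow> a = 0"
  by (metis Const_def Const_simps(1) lookup_single_eq)

lemma single_eq_Const_mult: "Poly_Mapping.single m c = Const c * Poly_Mapping.single m 1"
  by (simp add: Const_def mult_single)

lemma poly_mapping_single_induct [case_names zero single add]: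
  assumes "P 0" "\<And>m c. P (Poly_Mapping.single m c)" "\<And>f g. P f \<Longrightarrow> P g \<Longrightarrow> P (f + g)"
  shows "P (f :: 'a \<Rightarrow>\<^sub>0 'b::monoid_add)"
proof (induction f rule: update_induct)
  case const
  show ?case by (fact assms(1))
next
  case (update f a b)
  have "Poly_Mapping.update a b f = f + Poly_Mapping.single a b"
    using update(1)
    by (intro poly_mapping_eqI)
      (auto simp: lookup_update lookup_add lookup_single in_keys_iff when_def)
  then show ?case using update assms by simp
qed

lemma single_single_power:
  "Poly_Mapping.single (Poly_Mapping.single v n) 1 = Var v ^ n"
proof (induction n)
  case (Suc n)
  have "Poly_Mapping.single (Poly_Mapping.single v (Suc n)) (1::complex)
      = Poly_Mapping.single (Poly_Mapping.single v 1) 1 * Poly_Mapping.single (Poly_Mapping.single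
          v n) 1"
    by (simp add: mult_single flip: single_add)
  then show ?case using Suc by (simp add: Var_def)
qed simp

text \<open>Constants and variables generate \<open>R\<close> as a ring, so an identity between two
  ring homomorphisms need only be checked on them.\<close>

lemma R_induct [case_names Const Var add mult]:
  assumes C: "\<And>c. P (Const c)" and V: "\<And>v. P (Var v)"
    and A: "\<And>f g. P f \<Longrightarrow> P g \<Longrightarrow> P (f + g)" and M: "\<And>f g. P f \<Longrightarrow> P g \<Longrightarrow> P (f * g)"
  shows "P (f :: R)"
proof (induction f rule: poly_mapping_single_induct)
  case zero
  show ?case using C[of 0] by simp
next
  case (single m c)
  have "P (Poly_Mapping.single m 1)"
  proof (induction m rule: poly_mapping_single_induct)
    case zero
    show ?case using C[of 1] by simp
  next
    case (single v n)
    have "P (Var v ^ n)"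
      using C[of 1] V M by (induction n) auto
    then show ?case by (simp add: single_single_power)
  next
    case (add m m')
    then show ?case using M by (metis mult.right_neutral mult_single)
  qed
  then show ?case using M C single_eq_Const_mult by metis
qed (use A in auto)

definition mon_eval :: "(var \<Rightarrow> 'b::comm_ring_1) \<Rightarrow> (var \<Rightarrow>\<^sub>0 nat) \<Rightarrow> 'b" where
  "mon_eval th m = (\<Prod>v\<in>UNIV. th v ^ Poly_Mapping.lookup m v)"

text \<open>The coefficient map \<open>k\<close> is a parameter so that one definition yields point
  evaluation, substitution, dilation and restriction to a parametrised curve.\<close>

definition insertion :: "(complex \<Rightarrow> 'b::comm_ring_1) \<Rightarrow> (var \<Rightarrow> 'b) \<Rightarrow> R \<Rightarrow> 'b" where
  "insertion k th f = (\<Sum>m\<in>Poly_Mapping.keys f. k (Poly_Mapping.lookup f m) * mon_eval th m)"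

lemma mon_eval_zero [simp]: "mon_eval th 0 = 1"
  by (simp add: mon_eval_def)

lemma mon_eval_add: "mon_eval th (m + n) = mon_eval th m * mon_eval th n"
  by (simp add: mon_eval_def lookup_add power_add prod.distrib)

lemma mon_eval_single: "mon_eval th (Poly_Mapping.single v n) = th v ^ n"
proof -
  have "mon_eval th (Poly_Mapping.single v n) = (\<Prod>u\<in>UNIV. if u = v then th u ^ n else 1)"
    unfolding mon_eval_def by (intro prod.cong) (auto simp: lookup_single when_def)
  then show ?thesis by simp
qed

lemma mon_eval_Var: "mon_eval Var m = Poly_Mapping.single m 1"
proof (induction m rule: poly_mapping_single_induct)
  case (single v n)
  show ?case by (simp add: mon_eval_single single_single_power)
qed (simp_all add: mon_eval_add mult_single)

locale coef_hom =
  fixes k :: "complex \<Rightarrow> 'b::comm_ring_1"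
  assumes k_add: "k (a + b) = k a + k b" and k_mult: "k (a * b) = k a * k b" and k_1: "k 1 = 1"
begin

lemma k_0: "k 0 = 0"
  using k_add[of 0 0] by simp

lemma insertion_superset:
  assumes "finite S" "Poly_Mapping.keys f \<subseteq> S"
  shows "insertion k th f = (\<Sum>m\<in>S. k (Poly_Mapping.lookup f m) * mon_eval th m)"
  unfolding insertion_def using assms
  by (intro sum.mono_neutral_left) (auto simp: in_keys_iff k_0)

lemma insertion_add [simp]: "insertion k th (f + g) = insertion k th f + insertion k th g"
proof -
  let ?S = "Poly_Mapping.keys f \<union> Poly_Mapping.keys g"
  have "insertion k th (f + g) = (\<Sum>m\<in>?S. k (Poly_Mapping.lookup (f + g) m) * mon_eval th m)"
    by (rule insertion_superset) (auto simp: keys_add)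
  moreover have "insertion k th f = (\<Sum>m\<in>?S. k (Poly_Mapping.lookup f m) * mon_eval th m)"
    by (rule insertion_superset) auto
  moreover have "insertion k th g = (\<Sum>m\<in>?S. k (Poly_Mapping.lookup g m) * mon_eval th m)"
    by (rule insertion_superset) auto
  ultimately show ?thesis
    by (simp add: lookup_add k_add distrib_right sum.distrib)
qed

lemma insertion_0 [simp]: "insertion k th 0 = 0"
  by (simp add: insertion_def)

lemma insertion_single: "insertion k th (Poly_Mapping.single m c) = k c * mon_eval th m"
  by (cases "c = 0") (auto simp: insertion_def k_0)

lemma insertion_Const [simp]: "insertion k th (Const c) = k c"
  by (simp add: Const_def insertion_single)

lemma insertion_1 [simp]: "insertion k th 1 = 1"
  using insertion_Const[of th 1] by (simp add: k_1)

lemma insertion_Var [simp]: "insertion k th (Var v) = th v"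
  by (simp add: Var_def insertion_single k_1 mon_eval_single)

lemma insertion_mult [simp]: "insertion k th (f * g) = insertion k th f * insertion k th g"
proof (induction f rule: poly_mapping_single_induct)
  case (single m c)
  show ?case
  proof (induction g rule: poly_mapping_single_induct)
    case (single m' c')
    show ?case by (simp add: mult_single insertion_single k_mult mon_eval_add mult_ac)
  qed (simp_all add: distrib_left)
qed (auto simp: distrib_right)

lemma insertion_power [simp]: "insertion k th (f ^ n) = insertion k th f ^ n"
  by (induction n) auto

lemma insertion_uminus [simp]: "insertion k th (- f) = - insertion k th f"
  using insertion_add[of th "- f" f] by (simp add: eq_neg_iff_add_eq_0)

lemma insertion_diff [simp]: "insertion k th (f - g) = insertion k th f - insertion k th g"
  using insertion_add[of th f "- g"] by simp

end

interpretation ev: coef_hom "\<lambda>c. c" by standard auto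
interpretation psubst: coef_hom Const by standard auto
interpretation dilation: coef_hom "\<lambda>c. [:Const c:]" by standard auto
interpretation curve: coef_hom "\<lambda>c. [:c:]" by standard auto

abbreviation ev :: "(var \<Rightarrow> complex) \<Rightarrow> R \<Rightarrow> complex" where
  "ev \<equiv> insertion (\<lambda>c. c)"

abbreviation psubst :: "(var \<Rightarrow> R) \<Rightarrow> R \<Rightarrow> R" where
  "psubst \<equiv> insertion Const"

text \<open>With T the variable of \<open>R poly\<close>, v is sent to th v + T (v - th v): T = 0
  gives the substitution \<open>th\<close>, and T = 1 gives back f.\<close>

definition dilation :: "(var \<Rightarrow> R) \<Rightarrow> R \<Rightarrow> R poly" where
  "dilation th = insertion (\<lambda>c. [:Const c:]) (\<lambda>v. [:th v, Var v - th v:])"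

abbreviation curve :: "(var \<Rightarrow> complex poly) \<Rightarrow> R \<Rightarrow> complex poly" where
  "curve \<equiv> insertion (\<lambda>c. [:c:])"

lemma dilation_simps [simp]:
  "dilation th 0 = 0" "dilation th 1 = 1" "dilation th (Const c) = [:Const c:]"
  "dilation th (Var v) = [:th v, Var v - th v:]"
  "dilation th (f + g) = dilation th f + dilation th g" "dilation th (f - g) = dilation th f
      - dilation th g"
  "dilation th (- f) = - dilation th f"
  "dilation th (f * g) = dilation th f * dilation th g" "dilation th (f ^ n) = dilation th f ^ n"
  by (simp_all add: dilation_def)

lemma coeff_dilation_0 [simp]: "coeff (dilation th f) 0 = psubst th f"
  by (induction f rule: R_induct) (auto simp: coeff_mult)

lemma poly_dilation_1 [simp]: "poly (dilation th f) 1 = f"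
  by (induction f rule: R_induct) auto

lemma dilation_eq_0_iff [simp]: "dilation th f = 0 \<longleftrightarrow> f = 0"
  by (metis dilation_simps(1) poly_0 poly_dilation_1)

lemma curve_eval: "poly (curve q f) t = ev (\<lambda>v. poly (q v) t) f"
  by (induction f rule: R_induct) auto

lemma ev_psubst: "ev p (psubst th f) = ev (\<lambda>v. ev p (th v)) f"
  by (induction f rule: R_induct) auto

text \<open>Kronecker substitution: replacing the variables by t, t^N, t^(N^2), t^(N^3), with N
  above every exponent in f, sends distinct monomials of f to distinct powers of t. Hence f becomes
  a nonzero polynomial in t.\<close>

lemma ev_nonzero:
  assumes "f \<noteq> 0"
  obtains p where "ev p f \<noteq> 0"
proof -
  define N where "N = Suc (Max ((\<lambda>(m, v). Poly_Mapping.lookup m v) ` (Poly_Mapping.keys f \<times> UNIV)))"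
  have small: "Poly_Mapping.lookup m v < N" if "m \<in> Poly_Mapping.keys f" for m v
    unfolding N_def less_Suc_eq_le using that by (intro Max_ge) force+
  define e :: "var \<Rightarrow> nat" where "e v = N ^ case_var 0 1 2 3 v" for v
  define w where "w m = (\<Sum>v\<in>UNIV. e v * Poly_Mapping.lookup m v)" for m
  have w: "w m = Poly_Mapping.lookup m X + N * (Poly_Mapping.lookup m Y
      + N * (Poly_Mapping.lookup m Z + N * Poly_Mapping.lookup m W))" for m
    by (simp add: w_def UNIV_var e_def algebra_simps power2_eq_square power3_eq_cube)
  have digit: "x = x' \<and> y = y'" if "x + N * y = x' + N * y'" "x < N" "x' < N" for x x' y y'
  proof
    show x: "x = x'"
      using arg_cong[OF that(1), of "\<lambda>n. n mod N"] that(2,3)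
      by (simp only: mod_mult_self2 mod_less)
    show "y = y'" using that x by simp
  qed
  have inj: "m = m'" if "m \<in> Poly_Mapping.keys f" "m' \<in> Poly_Mapping.keys f" "w m = w m'" for m m'
  proof (rule poly_mapping_eqI)
    fix v
    note d1 = digit[OF that(3)[unfolded w] small[OF that(1)] small[OF that(2)]]
    note d2 = digit[OF conjunct2[OF d1] small[OF that(1)] small[OF that(2)]]
    note d3 = digit[OF conjunct2[OF d2] small[OF that(1)] small[OF that(2)]]
    show "Poly_Mapping.lookup m v = Poly_Mapping.lookup m' v"
      using d1 d2 d3 by (cases v) auto
  qed
  define q :: "var \<Rightarrow> complex poly" where "q v = monom 1 (e v)" for v
  have mq: "mon_eval q m = monom 1 (w m)" for m
  proof -
    have "(\<Prod>v\<in>S. q v ^ Poly_Mapping.lookup m v) = monom 1 (\<Sum>v\<in>S. e v * Poly_Mapping.lookup m v)"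
      if "finite S" for S
      using that by (induction S rule: finite_induct) (auto simp: q_def monom_power mult_monom)
    then show ?thesis by (simp add: mon_eval_def w_def)
  qed
  obtain m0 where m0: "m0 \<in> Poly_Mapping.keys f"
    using assms by (metis all_not_in_conv keys_eq_empty)
  have "coeff (curve q f) (w m0)
      = (\<Sum>m\<in>Poly_Mapping.keys f. if m = m0 then Poly_Mapping.lookup f m else 0)"
    unfolding insertion_def coeff_sum mq
    by (intro sum.cong) (use inj m0 in auto)
  also have "\<dots> \<noteq> 0" using m0 by (simp add: in_keys_iff)
  finally have "curve q f \<noteq> 0" by auto
  then obtain t where "poly (curve q f) t \<noteq> 0"
    using poly_all_0_iff_0 by blast
  then show ?thesis using that by (simp add: curve_eval)
qed

section \<open>Vanishing along a linear space\<close>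

lemma is_idealD:
  assumes "is_ideal I"
  shows "0 \<in> I" "a \<in> I \<Longrightarrow> b \<in> I \<Longrightarrow> a + b \<in> I" "a \<in> I \<Longrightarrow> r * a \<in> I" "a \<in> I \<Longrightarrow> a * r \<in> I"
    "a \<in> I \<Longrightarrow> - a \<in> I" "a \<in> I \<Longrightarrow> b \<in> I \<Longrightarrow> a - b \<in> I"
proof -
  show add: "a + b \<in> I" if "a \<in> I" "b \<in> I" for a b using that assms by (auto simp: is_ideal_def)
  show mult: "r * a \<in> I" if "a \<in> I" for r a using that assms by (auto simp: is_ideal_def)
  show "0 \<in> I" using assms by (auto simp: is_ideal_def)
  show "a * r \<in> I" if "a \<in> I" using mult[OF that, of r] by (simp add: mult.commute)
  show um: "- a \<in> I" if "a \<in> I" for a using mult[OF that, of "-1"] by simp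
  show "a - b \<in> I" if "a \<in> I" "b \<in> I" using add[OF that(1) um[OF that(2)]] by simp
qed

lemma is_ideal_ideal_gen: "is_ideal (ideal_gen S)"
  unfolding ideal_gen_def is_ideal_def by blast

lemma ideal_gen_superset: "S \<subseteq> ideal_gen S"
  unfolding ideal_gen_def by blast

lemma ideal_gen_least: "is_ideal J \<Longrightarrow> S \<subseteq> J \<Longrightarrow> ideal_gen S \<subseteq> J"
  unfolding ideal_gen_def by blast

lemma is_ideal_I3: "is_ideal I3"
  by (simp add: I3_def Let_def is_ideal_ideal_gen)

lemma prod_list_in_ideal_power:
  "length xs = m \<Longrightarrow> set xs \<subseteq> I \<Longrightarrow> prod_list xs \<in> ideal_power I m"
  unfolding ideal_power_def by (rule subsetD[OF ideal_gen_superset]) blast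

lemma is_ideal_ideal_power: "is_ideal (ideal_power I m)"
  by (simp add: ideal_power_def is_ideal_ideal_gen)

lemma ideal_power_mult:
  assumes a: "a \<in> ideal_power I m" and b: "b \<in> ideal_power I n"
  shows "a * b \<in> ideal_power I (m + n)"
proof -
  note ip = is_idealD[OF is_ideal_ideal_power[of I "m + n"]]
  have 1: "prod_list xs * b \<in> ideal_power I (m + n)"
    if "b \<in> ideal_power I n" "length xs = m" "set xs \<subseteq> I" for xs b
  proof -
    have "ideal_power I n \<subseteq> {b. prod_list xs * b \<in> ideal_power I (m + n)}"
      unfolding ideal_power_def[of I n]
    proof (rule ideal_gen_least)
      show "is_ideal {b. prod_list xs * b \<in> ideal_power I (m + n)}"
        using ip(1-3) by (simp add: is_ideal_def distrib_left mult.left_commute[of "prod_list xs"])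
      have "prod_list xs * prod_list ys \<in> ideal_power I (m + n)" if "length ys = n" "set ys \<subseteq> I"
          for ys
        using prod_list_in_ideal_power[of "xs @ ys" "m + n" I] that \<open>length xs = m\<close> \<open>set xs \<subseteq> I\<close>
        by simp
      then show "{prod_list xs |xs. length xs = n \<and> set xs \<subseteq> I} \<subseteq> {b. prod_list xs * b
          \<in> ideal_power I (m + n)}"
        by blast
    qed
    then show ?thesis using that by blast
  qed
  have "ideal_power I m \<subseteq> {a. a * b \<in> ideal_power I (m + n)}"
    unfolding ideal_power_def[of I m]
  proof (rule ideal_gen_least)
    show "is_ideal {a. a * b \<in> ideal_power I (m + n)}"
      using ip(1-3) by (simp add: is_ideal_def distrib_right mult.assoc)
  qed (use 1 b in auto)
  then show ?thesis using a by blast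
qed

lemma ideal_power_1: "a \<in> I \<Longrightarrow> a \<in> ideal_power I 1"
  using prod_list_in_ideal_power[of "[a]" 1 I] by simp

lemma ideal_power_power:
  assumes "a \<in> ideal_power I m"
  shows "a ^ n \<in> ideal_power I (m * n)"
proof (induction n)
  case 0
  show ?case using prod_list_in_ideal_power[of "[]" 0 I] by simp
next
  case (Suc n)
  then show ?case using ideal_power_mult[OF assms Suc] by simp
qed

lemma prime_ideal_power:
  "is_prime_ideal P \<Longrightarrow> a ^ n \<in> P \<Longrightarrow> a \<in> P"
proof (induction n)
  case 0
  then have "1 \<in> P" by simp
  then have "r \<in> P" for r
    using 0(1) is_idealD(3)[of P 1 r] by (simp add: is_prime_ideal_def)
  then show ?case by blast
qed (auto simp: is_prime_ideal_def)

lemma is_prime_ideal_kernel: "is_prime_ideal {f. psubst th f = 0}"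
  unfolding is_prime_ideal_def is_ideal_def
proof (intro conjI)
  have "1 \<notin> {f. psubst th f = 0}" by simp
  then show "{f. psubst th f = 0} \<noteq> UNIV" by blast
qed auto

text \<open>The difference lies in the ideal generated by all \<open>Var v - th v\<close>; for a
  product this follows by telescoping.\<close>

lemma diff_psubst_times_in_ideal:
  assumes "is_ideal I" "\<And>v. (Var v - th v) * h \<in> I"
  shows "(f - psubst th f) * h \<in> I"
proof (induction f rule: R_induct)
  case (add f g)
  have "(f + g - psubst th (f + g)) * h = (f - psubst th f) * h + (g - psubst th g) * h"
    by (simp add: algebra_simps)
  then show ?case using add is_idealD[OF assms(1)] by metis
next
  case (mult f g)
  have "(f * g - psubst th (f * g)) * h = f * ((g - psubst th g) * h) + psubst th g * ((f
      - psubst th f) * h)"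
    by (simp add: algebra_simps)
  then show ?case using mult is_idealD[OF assms(1)] by metis
qed (use assms is_idealD[OF assms(1)] in auto)

text \<open>The kernel is prime and misses h, which gives one inclusion. For the other, an f in the
  kernel equals \<open>f - psubst th f\<close>, and that multiplies h into I.\<close>

lemma ideal_colon_eq_kernel:
  assumes "is_ideal I" "I \<subseteq> {f. psubst th f = 0}"
    and "\<And>v. (Var v - th v) * h \<in> I" "psubst th h \<noteq> 0"
  shows "ideal_colon I h = {f. psubst th f = 0}"
proof (intro set_eqI iffI)
  fix f assume "f \<in> ideal_colon I h"
  then have "psubst th (f * h) = 0" using assms(2) by (auto simp: ideal_colon_def)
  then show "f \<in> {f. psubst th f = 0}" using assms(4) by simp
next
  fix f assume "f \<in> {f. psubst th f = 0}"
  then show "f \<in> ideal_colon I h"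
    using diff_psubst_times_in_ideal[OF assms(1,3), of f] by (simp add: ideal_colon_def)
qed

section \<open>Order of vanishing along the fixed space of a projection\<close>

lemma monom_1_dvd_mult_cancel:
  fixes p q :: "'a::idom poly"
  assumes "monom 1 n dvd p * q" "coeff p 0 \<noteq> 0"
  shows "monom 1 n dvd q"
proof (cases "q = 0")
  case False
  have "p \<noteq> 0" using assms(2) by auto
  moreover have "order 0 p = 0" using assms(2) by (simp add: order_0I poly_0_coeff_0)
  ultimately show ?thesis
    using assms(1) False by (simp add: monom_1_dvd_iff order_mult)
qed simp

text \<open>Each factor from I has a dilation with zero constant coefficient, so it contributes one
  factor T.\<close>

lemma dilation_ideal_power:
  assumes I: "I \<subseteq> {f. psubst th f = 0}" and f: "f \<in> ideal_power I n"
  shows "monom 1 n dvd dilation th f"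
proof -
  have *: "monom 1 (length xs) dvd dilation th (prod_list xs)" if "set xs \<subseteq> I" for xs
    using that
  proof (induction xs)
    case (Cons x xs)
    have "coeff (dilation th x) 0 = 0" using Cons I by auto
    then have "monom 1 1 dvd dilation th x" by (simp only: monom_1_dvd_iff') simp
    then have "monom 1 1 * monom 1 (length xs) dvd dilation th x * dilation th (prod_list xs)"
      using Cons by (intro mult_dvd_mono) auto
    then show ?case by (simp add: mult_monom)
  qed simp
  have "ideal_power I n \<subseteq> {f. monom 1 n dvd dilation th f}"
    unfolding ideal_power_def by (rule ideal_gen_least) (use * in \<open>auto simp: is_ideal_def\<close>)
  then show ?thesis using f by blast
qed

text \<open>\<open>dilation th\<close> is the dilation towards the fixed space of the projection
    \<open>th\<close>, so divisibility of
\<open>dilation th f\<close> by \<open>T\<^sup>n\<close> says that \<open>f\<close> vanishes to order at least \<open>n\<close> along that space.\<close>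

lemma dilation_symbolic_power:
  assumes "is_ideal I" "I \<subseteq> {f. psubst th f = 0}"
    and "\<And>v. (Var v - th v) * h \<in> I" "psubst th h \<noteq> 0"
    and f: "f \<in> symbolic_power I n"
  shows "monom 1 n dvd dilation th f"
proof -
  have "{f. psubst th f = 0} \<in> Ass I"
    unfolding Ass_def using is_prime_ideal_kernel ideal_colon_eq_kernel[OF assms(1-4)] by blast
  then obtain s where "psubst th s \<noteq> 0" "s * f \<in> ideal_power I n"
    using f by (fastforce simp: symbolic_power_def loc_contract_def)
  then show ?thesis
    using dilation_ideal_power[OF assms(2), of "s * f" n] monom_1_dvd_mult_cancel[of n
        "dilation th s" "dilation th f"]
    by simp
qed

text \<open>The \<open>k\<close>-th coefficient of \<open>dilation th f\<close> lies in the \<open>k\<close>-th power of the ideal of the space,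
and the coefficients add up to \<open>f\<close>.\<close>

lemma dvd_curve_of_dilation:
  assumes "monom 1 n dvd dilation th f" and r: "\<And>v. poly (curve q (Var v - th v)) r = 0"
  shows "[:- r, 1:] ^ n dvd curve q f"
proof -
  have *: "[:- r, 1:] ^ k dvd curve q (coeff (dilation th g) k)" for g k
  proof (induction g arbitrary: k rule: R_induct)
    case (Const c)
    then show ?case by (cases k) auto
  next
    case (Var v)
    show ?case
    proof (cases k)
      case (Suc k')
      then show ?thesis using r[of v] by (cases k') (auto simp flip: poly_eq_0_iff_dvd)
    qed auto
  next
    case (mult f g)
    have sum: "curve q (\<Sum>i\<in>A. h i) = (\<Sum>i\<in>A. curve q (h i))" for A :: "nat set" and h
      by (induction A rule: infinite_finite_induct) auto
    have "[:- r, 1:] ^ k dvd curve q (coeff (dilation th f) i * coeff (dilation th g) (k - i))" if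
        "i \<le> k" for i
      using mult_dvd_mono[OF mult(1)[of i] mult(2)[of "k - i"]] that
      by (simp flip: power_add)
    then show ?case by (auto simp: coeff_mult sum intro!: dvd_sum)
  qed auto
  have sum: "curve q (\<Sum>i\<in>A. h i) = (\<Sum>i\<in>A. curve q (h i))" for A :: "nat set" and h
    by (induction A rule: infinite_finite_induct) auto
  have "f = (\<Sum>k\<le>degree (dilation th f). coeff (dilation th f) k)"
    by (metis (no_types, lifting) mult.right_neutral poly_altdef poly_dilation_1 power_one sum.cong)
  also have "curve q \<dots> = (\<Sum>k\<le>degree (dilation th f). curve q (coeff (dilation th f) k))"
    by (rule sum)
  also have "[:- r, 1:] ^ n dvd \<dots>"
  proof (rule dvd_sum)
    fix k
    show "[:- r, 1:] ^ n dvd curve q (coeff (dilation th f) k)"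
    proof (cases "k < n")
      case True
      then show ?thesis using assms(1) by (simp add: monom_1_dvd_iff')
    next
      case False
      then show ?thesis using *[of k f] by (meson dvd_trans le_imp_power_dvd not_less)
    qed
  qed
  finally show ?thesis .
qed

section \<open>Homogeneous polynomials\<close>

abbreviation scaling :: "R \<Rightarrow> R poly" where
  "scaling \<equiv> dilation (\<lambda>_. 0)"

lemma scaling_eq: "scaling f = (\<Sum>m\<in>Poly_Mapping.keys f. monom (Poly_Mapping.single m
    (Poly_Mapping.lookup f m)) (mon_deg m))"
proof -
  have "mon_eval (\<lambda>v. [:0, Var v - 0:]) m = monom (Poly_Mapping.single m 1) (mon_deg m)" for m
  proof -
    have 1: "(\<Prod>v\<in>S. [:0, Var v - 0:] ^ Poly_Mapping.lookup m v)
        = monom (\<Prod>v\<in>S. Var v ^ Poly_Mapping.lookup m v) (\<Sum>v\<in>S. Poly_Mapping.lookup m v)" if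
            "finite S" for S
      using that
    proof (induction S rule: finite_induct)
      case (insert v S)
      have "[:0, Var v - 0:] = monom (Var v) 1" by (simp add: monom_altdef)
      then show ?case using insert by (simp add: monom_power mult_monom)
    qed simp
    have 2: "(\<Prod>v\<in>UNIV. Var v ^ Poly_Mapping.lookup m v) = Poly_Mapping.single m 1"
      using mon_eval_Var[of m] by (simp add: mon_eval_def)
    have 3: "(\<Sum>v\<in>UNIV. Poly_Mapping.lookup m v) = mon_deg m"
      unfolding mon_deg_def by (rule sum.mono_neutral_right) (auto simp: in_keys_iff)
    show ?thesis unfolding mon_eval_def by (simp only: 1[OF finite] 2 3)
  qed
  then show ?thesis
    unfolding dilation_def insertion_def
    by (intro sum.cong) (auto simp: monom_0[symmetric] mult_monom simp flip: single_eq_Const_mult)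
qed

text \<open>Scaling multiplies the part of degree k by T^k. As an equation in \<open>R poly\<close>,
  homogeneity passes easily to products, powers and factors.\<close>

lemma homogeneous_iff_scaling: "homogeneous_of_degree d f \<longleftrightarrow> scaling f = monom f d"
proof
  have f: "f = (\<Sum>m\<in>Poly_Mapping.keys f. Poly_Mapping.single m (Poly_Mapping.lookup f m))"
    by (rule poly_mapping_eqI)
      (auto simp: lookup_sum lookup_single when_def in_keys_iff)
  assume "homogeneous_of_degree d f"
  then have "scaling f = (\<Sum>m\<in>Poly_Mapping.keys f. monom (Poly_Mapping.single m
      (Poly_Mapping.lookup f m)) d)"
    unfolding scaling_eq homogeneous_of_degree_def by (intro sum.cong) auto
  also have "\<dots> = monom (\<Sum>m\<in>Poly_Mapping.keys f. Poly_Mapping.single m (Poly_Mapping.lookup f m)) d"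
    by (simp add: poly_eq_iff coeff_sum)
  finally show "scaling f = monom f d" using f by simp
next
  assume h: "scaling f = monom f d"
  show "homogeneous_of_degree d f"
    unfolding homogeneous_of_degree_def
  proof
    fix m assume m: "m \<in> Poly_Mapping.keys f"
    have "Poly_Mapping.lookup (coeff (scaling f) (mon_deg m)) m
        = (\<Sum>m'\<in>Poly_Mapping.keys f. if m' = m then Poly_Mapping.lookup f m' else 0)"
      unfolding scaling_eq coeff_sum lookup_sum
      by (intro sum.cong) (auto simp: lookup_single when_def)
    also have "\<dots> \<noteq> 0" using m by (simp add: in_keys_iff)
    finally show "mon_deg m = d" using h by (auto split: if_splits)
  qed
qed

lemma homogeneous_mult:
  "homogeneous_of_degree d f \<Longrightarrow> homogeneous_of_degree e g \<Longrightarrow> homogeneous_of_degree (d + e) (f * g)"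
  by (simp add: homogeneous_iff_scaling mult_monom)

lemma homogeneous_power:
  "homogeneous_of_degree d f \<Longrightarrow> homogeneous_of_degree (d * n) (f ^ n)"
  by (simp add: homogeneous_iff_scaling monom_power)

lemma homogeneous_Var: "homogeneous_of_degree 1 (Var v)"
  by (simp add: homogeneous_iff_scaling monom_altdef)

lemma homogeneous_diff:
  "homogeneous_of_degree d f \<Longrightarrow> homogeneous_of_degree d g \<Longrightarrow> homogeneous_of_degree d (f - g)"
  by (simp add: homogeneous_iff_scaling diff_monom)

text \<open>Compare the coefficients of T in (f g) T^d = f T^e \<open>scaling g\<close> and cancel
  f.\<close>

lemma homogeneous_factor:
  assumes "homogeneous_of_degree d (f * g)" "homogeneous_of_degree e f" "f \<noteq> 0" "g \<noteq> 0"
  shows "e \<le> d \<and> homogeneous_of_degree (d - e) g"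
proof -
  have "monom (f * g) d = monom f e * scaling g"
    using assms(1,2) by (simp add: homogeneous_iff_scaling)
  then have 1: "(if k = d then f * g else 0) = (if k < e then 0 else f * coeff (scaling g) (k
      - e))" for k
    by (metis coeff_monom coeff_monom_mult not_less)
  from 1[of d] assms(3,4) have "e \<le> d" by (auto split: if_splits)
  moreover have "coeff (scaling g) k = coeff (monom g (d - e)) k" for k
    using 1[of "k + e"] assms(3) \<open>e \<le> d\<close> by (auto split: if_splits)
  ultimately show ?thesis by (simp add: homogeneous_iff_scaling poly_eq_iff)
qed

lemma degree_curve_le:
  assumes "homogeneous_of_degree d f" "\<And>v. degree (q v) \<le> 1"
  shows "degree (curve q f) \<le> d"
  unfolding insertion_def
proof (rule degree_sum_le)
  fix m assume m: "m \<in> Poly_Mapping.keys f"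
  have "degree (mon_eval q m) \<le> (\<Sum>v\<in>UNIV. degree (q v ^ Poly_Mapping.lookup m v))"
    unfolding mon_eval_def
    using degree_prod_sum_le[of UNIV "\<lambda>v. q v ^ Poly_Mapping.lookup m v"] by (simp add: o_def)
  also have "\<dots> \<le> (\<Sum>v\<in>UNIV. Poly_Mapping.lookup m v)"
  proof (rule sum_mono)
    fix v
    show "degree (q v ^ Poly_Mapping.lookup m v) \<le> Poly_Mapping.lookup m v"
      using order_trans[OF degree_power_le[of "q v" "Poly_Mapping.lookup m v"]
        mult_right_mono[OF assms(2)[of v], of "Poly_Mapping.lookup m v"]] by simp
  qed
  also have "\<dots> = mon_deg m"
    unfolding mon_deg_def by (rule sum.mono_neutral_right) (auto simp: in_keys_iff)
  also have "\<dots> = d" using assms(1) m by (simp add: homogeneous_of_degree_def)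
  finally show "degree ([:Poly_Mapping.lookup f m:] * mon_eval q m) \<le> d"
    using degree_smult_le[of "Poly_Mapping.lookup f m" "mon_eval q m"] by simp
qed simp

section \<open>The line configuration\<close>

abbreviation cube_diff :: "var \<Rightarrow> var \<Rightarrow> R" where
  "cube_diff u v \<equiv> Var u ^ 3 - Var v ^ 3"

definition I3_gen :: "var \<Rightarrow> var \<Rightarrow> var \<Rightarrow> var \<Rightarrow> R" where
  "I3_gen p q r s = cube_diff p q * cube_diff r s * Var p * Var q"

definition fermat :: R where
  "fermat = cube_diff X Y * cube_diff Z W * cube_diff X Z * cube_diff Y W * cube_diff X W *
      cube_diff Y Z"

lemma Var_cube_eq_iff [simp]: "Var u ^ 3 = Var v ^ 3 \<longleftrightarrow> u = v"
proof
  assume "Var u ^ 3 = Var v ^ 3"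
  then have "ev (\<lambda>x. if x = u then 1 else 0) (Var u ^ 3) = ev (\<lambda>x. if x
      = u then 1 else 0) (Var v ^ 3)"
    by simp
  then show "u = v" by (auto split: if_splits)
qed auto

lemma Var_nonzero [simp]: "Var u \<noteq> 0"
  using ev.insertion_Var[of "\<lambda>_. 1" u] by (metis ev.insertion_0 zero_neq_one)

lemma fermat_nonzero: "fermat \<noteq> 0"
  by (simp add: fermat_def)

text \<open>Exchanging p with q, or r with s, only changes the sign; this reduces all orderings of
  the variables to the six given generators.\<close>

lemma I3_gen_in_I3:
  assumes "distinct [p, q, r, s]"
  shows "I3_gen p q r s \<in> I3"
proof -
  have base: "I3_gen X Y Z W \<in> I3" "I3_gen Z W X Y \<in> I3" "I3_gen X Z Y W \<in> I3" "I3_gen Y W X Z \<in> I3"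
    "I3_gen X W Y Z \<in> I3" "I3_gen Y Z X W \<in> I3"
    unfolding I3_def Let_def I3_gen_def
    by (rule subsetD[OF ideal_gen_superset], simp add: mult_ac)+
  have swap1: "I3_gen b a c d \<in> I3" if "I3_gen a b c d \<in> I3" for a b c d
    using is_idealD(5)[OF is_ideal_I3 that] by (simp add: I3_gen_def algebra_simps)
  have swap2: "I3_gen a b d c \<in> I3" if "I3_gen a b c d \<in> I3" for a b c d
    using is_idealD(5)[OF is_ideal_I3 that] by (simp add: I3_gen_def algebra_simps)
  show ?thesis
    using assms
    by (cases p; cases q; cases r; cases s;
        simp add: base base[THEN swap1] base[THEN swap2] base[THEN swap1, THEN swap2])
qed

lemma I3_subset:
  assumes "is_ideal J" "I3_gen X Y Z W \<in> J" "I3_gen Z W X Y \<in> J" "I3_gen X Z Y W \<in> J"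
      "I3_gen Y W X Z \<in> J"
    "I3_gen X W Y Z \<in> J" "I3_gen Y Z X W \<in> J"
  shows "I3 \<subseteq> J"
  unfolding I3_def Let_def
  by (rule ideal_gen_least[OF assms(1)]) (use assms(2-) in \<open>simp add: I3_gen_def mult_ac\<close>)

text \<open>The 42 lines are the fixed spaces of two families of projections: six from
  \<open>coord_proj\<close>, and 36 from \<open>diag_proj\<close> with e and e' running over the
  cube roots of unity.\<close>

abbreviation coord_proj :: "var \<Rightarrow> var \<Rightarrow> var \<Rightarrow> R" where
  "coord_proj a b \<equiv> Var(a := 0, b := 0)"

abbreviation diag_proj :: "var \<Rightarrow> var \<Rightarrow> var \<Rightarrow> complex \<Rightarrow> complex \<Rightarrow> var \<Rightarrow> R" where
  "diag_proj p q r e e' \<equiv> Var(q := Const e * Var p, r := Const e' * Var p)"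

lemma obtain_vars2:
  fixes a b :: var
  assumes "a \<noteq> b"
  obtains c d where "distinct [a, b, c, d]" "UNIV = {a, b, c, d}"
proof -
  have "card (UNIV - {a, b}) = 2"
    using assms by (simp add: card_Diff_subset) (simp add: UNIV_var)
  then obtain c d where "UNIV - {a, b} = {c, d}" "c \<noteq> d"
    by (auto simp: card_2_iff)
  then show ?thesis using assms by (intro that[of c d]) auto
qed

lemma obtain_vars3:
  fixes p q r :: var
  assumes "distinct [p, q, r]"
  obtains s where "distinct [p, q, r, s]" "UNIV = {p, q, r, s}"
proof -
  obtain c d where cd: "distinct [p, q, c, d]" "UNIV = {p, q, c, d}"
    using assms obtain_vars2[of p q] by auto
  have "r \<in> {p, q, c, d}" using cd(2) by blast
  then consider "r = c" | "r = d" using assms by auto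
  then show ?thesis
  proof cases
    case 1 then show ?thesis using cd that by blast
  next
    case 2 then show ?thesis using cd by (intro that[of c]) auto
  qed
qed

lemma distinct4_UNIV:
  fixes p q r s :: var
  assumes "distinct [p, q, r, s]"
  shows "UNIV = {p, q, r, s}"
proof -
  have "card (UNIV :: var set) = card {p, q, r, s}"
    using assms by (simp add: UNIV_var)
  then show ?thesis using card_subset_eq[of UNIV "{p, q, r, s}"] by simp
qed

lemma Const_cube_root: "e ^ 3 = 1 \<Longrightarrow> Const e ^ 3 = 1"
  by (metis Const_power Const_simps(2))

lemma I3_subset_kernel_coord_proj:
  assumes "a \<noteq> b"
  shows "I3 \<subseteq> {f. psubst (coord_proj a b) f = 0}"
  by (rule I3_subset) (use assms is_prime_ideal_kernel in
      \<open>(cases a; cases b; simp add: is_prime_ideal_def I3_gen_def)+\<close>)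

text \<open>On a diagonal line all cubes agree except that of the remaining variable s. A difference
  of two cubes thus vanishes there as soon as s is absent from it, and every generator has such a
  factor.\<close>

lemma psubst_diag_proj_cube:
  assumes "distinct [p, q, r, s]" "e ^ 3 = 1" "e' ^ 3 = 1"
  shows "diag_proj p q r e e' v ^ 3 = (if v = s then Var s ^ 3 else Var p ^ 3)"
  using assms UNIV_I[of v] unfolding distinct4_UNIV[OF assms(1)]
  by (auto simp: power_mult_distrib Const_cube_root)

lemma I3_subset_kernel_diag_proj:
  assumes "distinct [p, q, r]" "e ^ 3 = 1" "e' ^ 3 = 1"
  shows "I3 \<subseteq> {f. psubst (diag_proj p q r e e') f = 0}"
proof -
  obtain s where s: "distinct [p, q, r, s]" using obtain_vars3[OF assms(1)] by blast
  have *: "psubst (diag_proj p q r e e') (I3_gen u v x y) = 0" if "(u \<noteq> s \<and> v \<noteq> s) \<or> (x \<noteq> s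
      \<and> y \<noteq> s)" for u v x y
    unfolding I3_gen_def psubst.insertion_mult psubst.insertion_diff psubst.insertion_power
        psubst.insertion_Var psubst_diag_proj_cube[OF s assms(2,3)]
    using that by auto
  show ?thesis
    by (rule I3_subset)
      (use is_prime_ideal_kernel in \<open>auto simp: is_prime_ideal_def intro!: *\<close>)
qed

text \<open>Order at least n along each of the 42 lines. This consequence of membership in the n-th
  symbolic power is all that the lower bound uses.\<close>

definition vanishes :: "nat \<Rightarrow> R \<Rightarrow> bool" where
  "vanishes n f \<longleftrightarrow>
    (\<forall>a b. a \<noteq> b \<longrightarrow> monom 1 n dvd dilation (coord_proj a b) f) \<and>
    (\<forall>p q r e e'. distinct [p, q, r] \<longrightarrow> e ^ 3 = 1 \<longrightarrow> e' ^ 3 = 1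
        \<longrightarrow> monom 1 n dvd dilation (diag_proj p q r e e') f)"

lemma vanishes_symbolic_power:
  assumes f: "f \<in> symbolic_power I3 n"
  shows "vanishes n f"
  unfolding vanishes_def
proof (intro conjI allI impI)
  fix a b :: var assume "a \<noteq> b"
  then obtain c d where cd: "distinct [a, b, c, d]" using obtain_vars2 by blast
  \<comment> \<open>Multiplying h by a or by b completes a generator, while on the line a = b = 0 it
    restricts to c^4 d^4.\<close>
  define h where "h = cube_diff a c * cube_diff b d * Var c * Var d"
  have "Var a * h = I3_gen a c b d * Var d" "Var b * h = I3_gen b d a c * Var c"
    by (simp_all add: I3_gen_def h_def mult_ac)
  then have "Var a * h \<in> I3" "Var b * h \<in> I3"
    using cd is_idealD(4)[OF is_ideal_I3 I3_gen_in_I3] by auto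
  then have "(Var v - coord_proj a b v) * h \<in> I3" for v
    using is_idealD(1)[OF is_ideal_I3] by simp
  moreover have "psubst (coord_proj a b) h \<noteq> 0" using cd by (auto simp: h_def)
  ultimately show "monom 1 n dvd dilation (coord_proj a b) f"
    using dilation_symbolic_power[OF is_ideal_I3 I3_subset_kernel_coord_proj[OF \<open>a \<noteq> b\<close>] _ _ f]
        by blast
next
  fix p q r :: var and e e' :: complex
  assume pqr: "distinct [p, q, r]" and e: "e ^ 3 = 1" "e' ^ 3 = 1"
  then obtain s where s: "distinct [p, q, r, s]" using obtain_vars3 by blast
  \<comment> \<open>For a cube root of unity c, \<open>E c v\<close> is the cofactor of v - c p in
    v^3 - p^3; on the plane v = c p it equals 3 (c p)^2.\<close>
  define E where "E c v = Var v ^ 2 + Const c * Var v * Var p + Const c ^ 2 * Var p ^ 2" for c v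
  have E: "(Var v - Const c * Var p) * E c v = cube_diff v p" if "c ^ 3 = 1" for c v
  proof -
    have "(Var v - Const c * Var p) * E c v = Var v ^ 3 - Const c ^ 3 * Var p ^ 3"
      by (simp add: E_def algebra_simps power2_eq_square power3_eq_cube)
    then show ?thesis using that by (simp add: Const_cube_root)
  qed
  \<comment> \<open>The two linear equations of the line are left out of h; putting either back
    produces a multiple of a generator.\<close>
  define h where "h = E e q * E e' r * cube_diff r s * cube_diff q s * Var p * Var q * Var r"
  have "(Var q - Const e * Var p) * h
      = ((Var q - Const e * Var p) * E e q) * E e' r * cube_diff r s * cube_diff q s * Var p * Var
          q * Var r"
    by (simp add: h_def mult_ac)
  also have "\<dots> = I3_gen q p r s * (E e' r * cube_diff q s * Var r)"
    unfolding E[OF e(1)] by (simp add: I3_gen_def mult_ac)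
  finally have 1: "(Var q - Const e * Var p) * h \<in> I3"
    using s is_idealD(4)[OF is_ideal_I3 I3_gen_in_I3[of q p r s]] by auto
  have "(Var r - Const e' * Var p) * h
      = ((Var r - Const e' * Var p) * E e' r) * E e q * cube_diff r s * cube_diff q s * Var p *
          Var q * Var r"
    by (simp add: h_def mult_ac)
  also have "\<dots> = I3_gen r p q s * (E e q * cube_diff r s * Var q)"
    unfolding E[OF e(2)] by (simp add: I3_gen_def mult_ac)
  finally have 2: "(Var r - Const e' * Var p) * h \<in> I3"
    using s is_idealD(4)[OF is_ideal_I3 I3_gen_in_I3[of r p q s]] by auto
  have "(Var v - diag_proj p q r e e' v) * h \<in> I3" for v
    using 1 2 is_idealD(1)[OF is_ideal_I3] by simp
  moreover have "psubst (diag_proj p q r e e') h \<noteq> 0"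
  proof -
    have "e \<noteq> 0" "e' \<noteq> 0" using e by auto
    moreover have "Const c * Var p * (Const c * Var p) + Const c * (Const c * Var p) * Var p
        + Const c * Const c * (Var p * Var p) = 3 * (Const c * Var p)^2" for c
      by (simp add: power2_eq_square mult_ac)
    ultimately show ?thesis
      using s pqr e by (auto simp: h_def E_def power2_eq_square power_mult_distrib Const_cube_root)
  qed
  ultimately show "monom 1 n dvd dilation (diag_proj p q r e e') f"
    using dilation_symbolic_power[OF is_ideal_I3 I3_subset_kernel_diag_proj[OF pqr e] _ _ f]
        by blast
qed

section \<open>Order of \<open>fermat\<close> along the 42 lines\<close>

lemma order_0_le:
  fixes p :: "'a::idom poly"
  assumes "coeff p n \<noteq> 0"
  shows "order 0 p \<le> n"
proof (rule ccontr)
  assume "\<not> ?thesis"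
  moreover have "p \<noteq> 0" using assms by auto
  ultimately have "monom 1 (Suc n) dvd p" by (simp add: monom_1_dvd_iff)
  then show False using assms unfolding monom_1_dvd_iff' by blast
qed

lemma coeff_linear_cube:
  fixes a b :: "'a::idom"
  shows "coeff ([:a, b:] ^ 3) 0 = a ^ 3" "coeff ([:a, b:] ^ 3) 1 = 3 * a ^ 2 * b"
    "coeff ([:a, b:] ^ 3) 3 = b ^ 3"
proof -
  have "[:a, b:] ^ 3 = [:a ^ 3, 3 * a ^ 2 * b, 3 * a * b ^ 2, b ^ 3:]"
    by (simp add: power3_eq_cube power2_eq_square algebra_simps)
  then show "coeff ([:a, b:] ^ 3) 0 = a ^ 3" "coeff ([:a, b:] ^ 3) 1 = 3 * a ^ 2 * b"
    "coeff ([:a, b:] ^ 3) 3 = b ^ 3"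
    by (simp_all add: numeral_3_eq_3)
qed

lemma fermat_order:
  assumes "order 0 (dilation th (cube_diff X Y)) + order 0 (dilation th (cube_diff Z W))
      + order 0 (dilation th (cube_diff X Z))
    + order 0 (dilation th (cube_diff Y W)) + order 0 (dilation th (cube_diff X W))
        + order 0 (dilation th (cube_diff Y Z)) \<le> 3"
  shows "monom 1 (n + 3) dvd dilation th (fermat * g) \<Longrightarrow> monom 1 n dvd dilation th g"
proof (cases "g = 0")
  case False
  assume a: "monom 1 (n + 3) dvd dilation th (fermat * g)"
  have nz: "dilation th (cube_diff u v) \<noteq> 0" if "u \<noteq> v" for u v
    using that dilation_eq_0_iff[of th "cube_diff u v"]
        by (simp del: dilation_simps dilation_eq_0_iff)
  have "order 0 (dilation th fermat) \<le> 3"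
    using assms nz unfolding fermat_def dilation_simps(8)
    by (subst order_mult, simp del: dilation_simps)+ (simp del: dilation_simps)
  moreover have "fermat * g \<noteq> 0" using False fermat_nonzero by simp
  ultimately show ?thesis
    using a False fermat_nonzero
    by (simp add: monom_1_dvd_iff order_mult del: dilation_simps add: dilation_simps(8))
qed simp

text \<open>On a coordinate line only the factor a^3 - b^3 vanishes, to order three. On a diagonal
  line the three factors without s vanish, each to order one. In both cases \<open>fermat\<close>
  has order at most three and can be cancelled.\<close>

lemma vanishes_fermat_cancel:
  assumes "vanishes (n + 3) (fermat * g)"
  shows "vanishes n g"
  unfolding vanishes_def
proof (intro conjI allI impI)
  fix a b :: var assume ab: "a \<noteq> b"
  have *: "order 0 (dilation (coord_proj a b) (cube_diff u v)) \<le> (if {u, v}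
      = {a, b} then 3 else 0)" if "u \<noteq> v" for u v
  proof -
    have "coeff (dilation (coord_proj a b) (cube_diff u v)) (if {u, v} = {a, b} then 3 else 0) \<noteq> 0"
      using that ab by (auto simp: doubleton_eq_iff coeff_linear_cube)
    then show ?thesis by (rule order_0_le)
  qed
  show "monom 1 n dvd dilation (coord_proj a b) g"
  proof (rule fermat_order)
    show "monom 1 (n + 3) dvd dilation (coord_proj a b) (fermat * g)" using assms ab
        by (auto simp: vanishes_def)
    show "order 0 (dilation (coord_proj a b) (cube_diff X Y))
        + order 0 (dilation (coord_proj a b) (cube_diff Z W))
        + order 0 (dilation (coord_proj a b) (cube_diff X Z))
      + order 0 (dilation (coord_proj a b) (cube_diff Y W))
          + order 0 (dilation (coord_proj a b) (cube_diff X W))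
          + order 0 (dilation (coord_proj a b) (cube_diff Y Z)) \<le> 3"
      using ab *[of X Y] *[of Z W] *[of X Z] *[of Y W] *[of X W] *[of Y Z]
      by (cases a; cases b; simp add: doubleton_eq_iff del: dilation_simps)
  qed
next
  fix p q r :: var and e e' :: complex
  assume pqr: "distinct [p, q, r]" and e: "e ^ 3 = 1" "e' ^ 3 = 1"
  then obtain s where s: "distinct [p, q, r, s]" "UNIV = {p, q, r, s}" using obtain_vars3 by blast
  let ?th = "diag_proj p q r e e'"
  have e0: "e \<noteq> 0" "e' \<noteq> 0" using e by auto
  \<comment> \<open>The T-coefficient of the dilation of u^3, for u = c p on the line, is 3 (c p)^2
    (u - c p). That of p^3 is zero, so \<open>lin\<close> settles pairs containing p, and
    \<open>lin2\<close> settles the pair q, r.\<close>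
  have lin: "Var u - Const c * Var p \<noteq> 0" if "u \<noteq> p" for u c
  proof
    assume "Var u - Const c * Var p = 0"
    then have "ev (\<lambda>v. if v = u then 1 else 0) (Var u - Const c * Var p) = 0" by simp
    then show False using that by simp
  qed
  have lin2: "3 * (Const e * Var p) ^ 2 * (Var q
      - Const e * Var p) \<noteq> 3 * (Const e' * Var p) ^ 2 * (Var r - Const e' * Var p)"
  proof
    assume "3 * (Const e * Var p) ^ 2 * (Var q - Const e * Var p)
        = 3 * (Const e' * Var p) ^ 2 * (Var r - Const e' * Var p)"
    then have "3 * ((Const e * Var p) ^ 2 * (Var q - Const e * Var p)
        - (Const e' * Var p) ^ 2 * (Var r - Const e' * Var p)) = 0"
      by (simp add: algebra_simps)
    then have "(Const e * Var p) ^ 2 * (Var q - Const e * Var p) - (Const e' * Var p) ^ 2 * (Var r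
        - Const e' * Var p) = 0"
      by simp
    \<comment> \<open>At this point q - e p = 1 and r - e' p = 0, so the expression takes the value
      e^2.\<close>
    then have "ev (\<lambda>v. if v = p then 1 else if v = q then e
        + 1 else e') ((Const e * Var p) ^ 2 * (Var q - Const e * Var p)
        - (Const e' * Var p) ^ 2 * (Var r - Const e' * Var p)) = 0"
      by simp
    then show False using s(1) e0 by (simp split: if_splits)
  qed
  have *: "order 0 (dilation ?th (cube_diff u v)) \<le> (if s \<in> {u, v} then 0 else 1)" if "u \<noteq> v"
      for u v
  proof -
    have "coeff (dilation ?th (cube_diff u v)) 0 \<noteq> 0" if "s \<in> {u, v}"
      unfolding coeff_dilation_0 psubst.insertion_diff psubst.insertion_power psubst.insertion_Var
          psubst_diag_proj_cube[OF s(1) e]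
      using that \<open>u \<noteq> v\<close> s(1) by auto
    moreover have "coeff (dilation ?th (cube_diff u v)) 1 \<noteq> 0" if "s \<notin> {u, v}"
    proof -
      have "u \<in> {p, q, r}" "v \<in> {p, q, r}" using s(2) that by auto
      then show ?thesis
        using \<open>u \<noteq> v\<close> pqr e0 lin lin2 lin2[symmetric]
        by (auto simp: coeff_linear_cube simp del: One_nat_def)
    qed
    ultimately show ?thesis by (cases "s \<in> {u, v}") (simp_all only: if_True if_False
        not_False_eq_True order_0_le)
  qed
  show "monom 1 n dvd dilation ?th g"
  proof (rule fermat_order)
    show "monom 1 (n + 3) dvd dilation ?th (fermat * g)" using assms pqr e
        by (auto simp: vanishes_def)
    show "order 0 (dilation ?th (cube_diff X Y)) + order 0 (dilation ?th (cube_diff Z W))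
        + order 0 (dilation ?th (cube_diff X Z))
      + order 0 (dilation ?th (cube_diff Y W)) + order 0 (dilation ?th (cube_diff X W))
          + order 0 (dilation ?th (cube_diff Y Z)) \<le> 3"
      using *[of X Y] *[of Z W] *[of X Z] *[of Y W] *[of X W] *[of Y Z]
      by (cases s; simp del: dilation_simps)
  qed
qed

section \<open>The lower bound\<close>

lemma card_mult_le_degree:
  fixes P :: "'a::idom poly"
  assumes "finite S" "P \<noteq> 0" "\<And>r. r \<in> S \<Longrightarrow> [:- r, 1:] ^ n dvd P"
  shows "card S * n \<le> degree P"
proof -
  have "card S * n = (\<Sum>r\<in>S. n)" by simp
  also have "\<dots> \<le> (\<Sum>r\<in>S. count (proots P) r)"
    using assms by (intro sum_mono) (simp add: order_divides)
  also have "\<dots> \<le> (\<Sum>r\<in>S \<union> set_mset (proots P). count (proots P) r)"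
    using assms(1) by (intro sum_mono2) auto
  also have "\<dots> = size (proots P)"
    unfolding size_multiset_overloaded_eq using assms(1)
    by (intro sum.mono_neutral_right) (auto simp: not_in_iff simp del: count_proots)
  also have "\<dots> \<le> degree P" by (rule size_proots_le)
  finally show ?thesis .
qed

text \<open>A general line in the plane a = w b meets the lines a = b = 0 and c = e = 0, three
  diagonal lines involving a, b, c and three involving a, b, e. If f were nonzero on the plane, its
  restriction to such a line would have 8 n zeros with multiplicity but degree at most d.\<close>

lemma vanishes_on_plane:
  assumes f: "vanishes n f" "homogeneous_of_degree d f" and d: "d < 8 * n"
    and ab: "a \<noteq> b" and w: "w ^ 3 = 1"
  shows "psubst (Var(a := Const w * Var b)) f = 0"
proof (rule ccontr)
  define g where "g = psubst (Var(a := Const w * Var b)) f"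
  assume "\<not> ?thesis"
  then have g: "g \<noteq> 0" by (simp add: g_def)
  obtain c e where ce: "distinct [a, b, c, e]" using ab obtain_vars2 by blast
  have ne: "h \<noteq> 0" if "ev p h \<noteq> 0" for h p using that by auto
  have "Var b - 1 \<noteq> 0" by (rule ne[of "\<lambda>_. 0"]) simp
  moreover have "(Var b - 1) ^ 3 - Var v ^ 3 \<noteq> 0" if "v \<noteq> b" for v
    by (rule ne[of "\<lambda>x. if x = b then 2 else 0"]) (use that in simp)
  \<comment> \<open>The extra factors express genericity: the slopes below are defined, and the
    eight parameters are distinct.\<close>
  ultimately have "g * (Var b - 1) * Var c * Var e * ((Var b - 1) ^ 3 - Var c ^ 3)
      * ((Var b - 1) ^ 3 - Var e ^ 3) * cube_diff c e \<noteq> 0"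
    using g ce by (simp del: right_minus_eq) (simp; metis)
  then obtain p where p: "ev p (g * (Var b - 1) * Var c * Var e * ((Var b - 1) ^ 3 - Var c ^ 3)
      * ((Var b - 1) ^ 3 - Var e ^ 3) * cube_diff c e) \<noteq> 0" by (rule ev_nonzero)
  define \<gamma> where "\<gamma> = p c / (p b - 1)"
  define \<delta> where "\<delta> = p e / (p b - 1)"
  from p have b1: "p b - 1 \<noteq> 0" and "p c \<noteq> 0" "p e \<noteq> 0" "p c ^ 3 \<noteq> p e ^ 3"
    "(p b - 1) ^ 3 \<noteq> p c ^ 3" "(p b - 1) ^ 3 \<noteq> p e ^ 3" and evg: "ev p g \<noteq> 0"
    by auto
  then have gd: "\<gamma> \<noteq> 0" "\<delta> \<noteq> 0" "\<gamma> ^ 3 \<noteq> \<delta> ^ 3" "\<gamma> ^ 3 \<noteq> 1" "\<delta> ^ 3 \<noteq> 1"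
    by (auto simp: \<gamma>_def \<delta>_def power_divide)
  \<comment> \<open>\<open>q\<close> parametrises a line in the plane; it meets eight of the 42 lines, at the parameters in
      \<open>S\<close>.\<close>
  define q where "q = (\<lambda>v. if v = a then [:0, w:] else if v = b then [:0, 1:]
    else if v = c then [:- \<gamma>, \<gamma>:] else [:- \<delta>, \<delta>:])"
  have UN: "v \<in> {a, b, c, e}" for v
    using distinct4_UNIV[OF ce] by auto
  have pc: "\<gamma> * (p b - 1) = p c" and pe: "\<delta> * (p b - 1) = p e"
    using b1 by (simp_all add: \<gamma>_def \<delta>_def)
  have "poly (curve q f) (p b) = ev p g"
    unfolding g_def ev_psubst curve_eval
  proof (rule arg_cong[of _ _ "\<lambda>x. ev x f"], rule ext)
    fix v
    show "poly (q v) (p b) = ev p ((Var(a := Const w * Var b)) v)"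
      using UN[of v] ce pc pe by (auto simp: q_def algebra_simps)
  qed
  then have nz: "curve q f \<noteq> 0" using evg by auto
  \<comment> \<open>At t = u / (u - 1) with u^3 = \<gamma>^3, the c-coordinate is \<gamma> / u times
    the b-coordinate, and \<gamma> / u is a cube root of unity. The same holds for e with
    \<delta>.\<close>
  define U where "U = {u. u ^ 3 = \<gamma> ^ 3} \<union> {u. u ^ 3 = \<delta> ^ 3}"
  define S where "S = {0, 1} \<union> (\<lambda>u. u / (u - 1)) ` U"
  have fin: "finite {u. u ^ 3 = z ^ 3}" if "z \<noteq> 0" for z :: complex
    using finite_nth_roots[of 3 "z ^ 3"] by simp
  have U1: "u \<noteq> 1 \<and> u \<noteq> 0" if "u \<in> U" for u
    using that gd by (auto simp: U_def)
  have cardU: "card U = 6"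
    unfolding U_def using gd fin card_nth_roots[of "\<gamma> ^ 3" 3] card_nth_roots[of "\<delta> ^ 3" 3]
    by (subst card_Un_disjoint) auto
  have finU: "finite U" using gd fin by (simp add: U_def)
  have "card ((\<lambda>u. u / (u - 1)) ` U) = 6"
    unfolding cardU[symmetric] by (rule card_image, rule inj_onI) (use U1 in
        \<open>auto simp: field_simps\<close>)
  moreover have "{0, 1} \<inter> (\<lambda>u. u / (u - 1)) ` U = {}"
    using U1 by (auto simp: field_simps)
  ultimately have cardS: "card S = 8"
    unfolding S_def using finU by (subst card_Un_disjoint) auto
  have dvd: "[:- r, 1:] ^ n dvd curve q f" if "r \<in> S" for r
  proof -
    from that consider "r = 0" | "r = 1"
      | u where "u ^ 3 = \<gamma> ^ 3" "r = u / (u - 1)" "u \<in> U" | u where "u ^ 3 = \<delta> ^ 3" "r = u / (u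
          - 1)" "u \<in> U"
      by (auto simp: S_def U_def)
    then show ?thesis
    proof cases
      case 1
      have "monom 1 n dvd dilation (coord_proj a b) f" using f(1) ab by (simp add: vanishes_def)
      then show ?thesis by (rule dvd_curve_of_dilation) (use ce 1 in \<open>auto simp: q_def\<close>)
    next
      case 2
      have "monom 1 n dvd dilation (coord_proj c e) f" using f(1) ce by (simp add: vanishes_def)
      then show ?thesis by (rule dvd_curve_of_dilation) (use ce 2 UN in \<open>auto simp: q_def\<close>)
    next
      case 3
      have u: "u \<noteq> 0" "u \<noteq> 1" using U1 3 by auto
      have "(\<gamma> / u) ^ 3 = 1" using 3 u gd by (simp add: power_divide)
      then have "monom 1 n dvd dilation (diag_proj b a c w (\<gamma> / u)) f"
        using f(1) ce w by (auto simp: vanishes_def)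
      then show ?thesis
        by (rule dvd_curve_of_dilation) (use ce 3 u in \<open>auto simp: q_def field_simps\<close>)
    next
      case 4
      have u: "u \<noteq> 0" "u \<noteq> 1" using U1 4 by auto
      have "(\<delta> / u) ^ 3 = 1" using 4 u gd by (simp add: power_divide)
      then have "monom 1 n dvd dilation (diag_proj b a e w (\<delta> / u)) f"
        using f(1) ce w by (auto simp: vanishes_def)
      then show ?thesis
        by (rule dvd_curve_of_dilation) (use ce 4 u in \<open>auto simp: q_def field_simps\<close>)
    qed
  qed
  have "card S * n \<le> degree (curve q f)"
    using finU dvd nz by (intro card_mult_le_degree) (auto simp: S_def)
  also have "\<dots> \<le> d"
    by (rule degree_curve_le[OF f(2)]) (simp add: q_def)
  finally show False using d cardS by simp
qed

section \<open>Divisibility by the forms of the planes and by \<open>fermat\<close>\<close>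

lemma diff_psubst_upd: "Var a - t dvd f - psubst (Var(a := t)) f"
proof (induction f rule: R_induct)
  case (add f g)
  then show ?case using dvd_add[OF add] by (simp add: algebra_simps)
next
  case (mult f g)
  have "f * g - psubst (Var(a := t)) (f * g)
      = f * (g - psubst (Var(a := t)) g) + psubst (Var(a := t)) g * (f - psubst (Var(a := t)) f)"
    by (simp add: algebra_simps)
  then show ?case using dvd_add[OF dvd_mult[OF mult(2)] dvd_mult[OF mult(1)]] by metis
qed auto

lemma dvd_of_psubst_upd_eq_0: "psubst (Var(a := t)) f = 0 \<Longrightarrow> Var a - t dvd f"
  using diff_psubst_upd[of a t f] by simp

text \<open>The three linear factors are split off one at a time: on the plane of the next factor,
  the earlier ones restrict to nonzero multiples of b and cancel.\<close>

lemma cube_diff_dvd: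
  assumes "a \<noteq> b" "\<And>w. w ^ 3 = 1 \<Longrightarrow> psubst (Var(a := Const w * Var b)) f = 0"
  shows "cube_diff a b dvd f"
proof -
  \<comment> \<open>A primitive cube root of unity.\<close>
  define z where "z = Complex (- 1 / 2) (sqrt 3 / 2)"
  have z: "z ^ 2 + z + 1 = 0"
    by (simp add: z_def complex_eq_iff power2_eq_square)
  have z3: "z ^ 3 = 1" "(z ^ 2) ^ 3 = 1"
    using z by algebra+
  have z1: "z \<noteq> 1" "z \<noteq> 0" "z ^ 2 \<noteq> 1" "z ^ 2 \<noteq> z"
    using z z3 by (auto simp: z_def complex_eq_iff power2_eq_square)
  have ne: "Const u * Var b - Const v * Var b \<noteq> 0" if "u \<noteq> v" for u v
  proof -
    have "Const u * Var b - Const v * Var b = Const (u - v) * Var b" by (simp add: algebra_simps)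
    then show ?thesis using that by (simp del: Const_simps)
  qed
  have "Var a - Const 1 * Var b dvd f" using assms(2)[of 1] by (intro dvd_of_psubst_upd_eq_0) simp
  then obtain f1 where f1: "f = (Var a - Const 1 * Var b) * f1" by (rule dvdE)
  have "psubst (Var(a := Const z * Var b)) f1 = 0"
    using assms(2)[OF z3(1)] ne[of z 1] z1 assms(1) by (simp add: f1)
  then obtain f2 where f2: "f1 = (Var a - Const z * Var b) * f2"
    using dvd_of_psubst_upd_eq_0 by (metis dvdE)
  have "psubst (Var(a := Const (z ^ 2) * Var b)) f2 = 0"
    using assms(2)[OF z3(2)] ne[of "z ^ 2" 1] ne[of "z ^ 2" z] z1 assms(1) by (simp add: f1 f2)
  then obtain f3 where f3: "f2 = (Var a - Const (z ^ 2) * Var b) * f3"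
    using dvd_of_psubst_upd_eq_0 by (metis dvdE)
  have "Const (z ^ 2 + z + 1) = 0" "Const (z ^ 3) = 1"
    using z z3 by (simp_all del: Const_simps(3) Const_power)
  then have "Const z ^ 2 + Const z + 1 = 0" by simp
  then have "cube_diff a b = (Var a - Const 1 * Var b) * (Var a - Const z * Var b) * (Var a
      - Const (z ^ 2) * Var b)"
    by (simp del: right_minus_eq) algebra
  then show ?thesis by (simp add: f1 f2 f3 mult_ac)
qed

text \<open>A coprimality argument: E is nonzero on each of the three planes, so v must vanish
  there.\<close>

lemma cube_diff_dvd_cancel:
  assumes "a \<noteq> b" "cube_diff a b dvd E * v" "\<And>w. w ^ 3
      = 1 \<Longrightarrow> psubst (Var(a := Const w * Var b)) E \<noteq> 0"
  shows "cube_diff a b dvd v"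
proof (rule cube_diff_dvd[OF assms(1)])
  fix w :: complex assume w: "w ^ 3 = 1"
  obtain k where "E * v = cube_diff a b * k" using assms(2) by (rule dvdE)
  then have "psubst (Var(a := Const w * Var b)) (E * v) = 0"
    using assms(1) w by (simp add: power_mult_distrib Const_cube_root)
  then show "psubst (Var(a := Const w * Var b)) v = 0" using assms(3)[OF w] by simp
qed

text \<open>The factors are collected one by one; the product of those already collected is nonzero
  on the planes of the next.\<close>

lemma fermat_dvd:
  assumes "\<And>a b. a \<noteq> b \<Longrightarrow> cube_diff a b dvd f"
  shows "fermat dvd f"
proof -
  have step: "E * cube_diff a b dvd f"
    if E: "E dvd f" and ab: "a \<noteq> b" and nz: "\<And>w. w ^ 3
        = 1 \<Longrightarrow> psubst (Var(a := Const w * Var b)) E \<noteq> 0" for E a b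
  proof -
    obtain k where k: "f = E * k" using E by (rule dvdE)
    then have "cube_diff a b dvd k" using cube_diff_dvd_cancel[OF ab _ nz] assms[OF ab] by blast
    then show ?thesis by (simp add: k)
  qed
  show ?thesis
    unfolding fermat_def
    by (intro step assms) (simp_all add: power_mult_distrib Const_cube_root)
qed

lemma homogeneous_cube_diff: "homogeneous_of_degree 3 (cube_diff a b)"
  using homogeneous_power[OF homogeneous_Var, of 3] by (intro homogeneous_diff) simp_all

lemma homogeneous_fermat: "homogeneous_of_degree 18 fermat"
  using homogeneous_mult[OF homogeneous_mult[OF homogeneous_mult[OF homogeneous_mult[OF
    homogeneous_mult[OF homogeneous_cube_diff[of X Y] homogeneous_cube_diff[of Z W]]
        homogeneous_cube_diff[of X Z]]
    homogeneous_cube_diff[of Y W]] homogeneous_cube_diff[of X W]] homogeneous_cube_diff[of Y Z]]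
  by (simp add: fermat_def)

lemma homogeneous_I3_gen: "homogeneous_of_degree 8 (I3_gen p q r s)"
  using homogeneous_mult[OF homogeneous_mult[OF homogeneous_mult[OF homogeneous_cube_diff[of p q]
    homogeneous_cube_diff[of r s]] homogeneous_Var[of p]] homogeneous_Var[of q]]
  by (simp add: I3_gen_def)

lemma fermat_dvd_of_small_degree:
  assumes "vanishes n f" "homogeneous_of_degree d f" "f \<noteq> 0" "d < 8 * n"
  obtains g where "f = fermat * g" "g \<noteq> 0" "18 \<le> d" "homogeneous_of_degree (d - 18) g"
proof -
  have "fermat dvd f"
    by (intro fermat_dvd cube_diff_dvd vanishes_on_plane[OF assms(1,2,4)])
  then obtain g where g: "f = fermat * g" by (rule dvdE)
  moreover have "g \<noteq> 0" using g assms(3) by auto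
  ultimately show ?thesis
    using homogeneous_factor[of d fermat g 18] homogeneous_fermat fermat_nonzero assms(2) that
        by blast
qed

text \<open>Splitting off \<open>fermat\<close> lowers the order by 3 and the degree by 18, which
  matches the step from m + 1 to m.\<close>

lemma degree_lower_bound:
  assumes "vanishes (3 * m + j) f" "homogeneous_of_degree d f" "f \<noteq> 0" "j \<le> 2"
  shows "18 * m + 8 * j \<le> d"
  using assms
proof (induction m arbitrary: f d)
  case 0
  show ?case
  proof (rule ccontr)
    assume "\<not> ?thesis"
    then have "d < 8 * (3 * 0 + j)" by simp
    \<comment> \<open>Divisibility by \<open>fermat\<close> forces d to be at least 18, whereas d <
      8 j and 8 j is at most 16.\<close>
    from fermat_dvd_of_small_degree[OF 0(1-3) this] show False using \<open>d < _\<close> 0(4) by auto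
  qed
next
  case (Suc m)
  show ?case
  proof (cases "d < 8 * (3 * Suc m + j)")
    case True
    then obtain g where g: "f = fermat * g" "g \<noteq> 0" "18 \<le> d" "homogeneous_of_degree (d - 18) g"
      using fermat_dvd_of_small_degree Suc.prems by blast
    have "vanishes (3 * m + j + 3) (fermat * g)" using Suc.prems(1)
        by (simp add: g(1) algebra_simps)
    then have "18 * m + 8 * j \<le> d - 18"
      using Suc.IH g Suc.prems(4) vanishes_fermat_cancel by blast
    then show ?thesis using g(3) by simp
  qed simp
qed

section \<open>The upper bound\<close>

definition quad1 :: R where "quad1 = cube_diff X Y * cube_diff Z W"
text \<open>The third product \<open>cube_diff X W * cube_diff Y Z\<close> equals
  \<open>quad2 - quad1\<close>, so two products suffice to express all generators.\<close>

definition quad2 :: R where "quad2 = cube_diff X Z * cube_diff Y W"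

text \<open>Equivalently, \<open>quad1 * u + quad2 * v\<close> vanishes on the six coordinate planes
  of C^4: on each plane one of \<open>quad1\<close>, \<open>quad2\<close> and
  \<open>quad2 - quad1\<close> is zero, and what remains is a nonzero multiple of v, u or u +
  v.\<close>

definition coord_vanish :: "R \<Rightarrow> R \<Rightarrow> bool" where
  "coord_vanish u v \<longleftrightarrow> psubst (coord_proj Z W) v = 0 \<and> psubst (coord_proj X Y) v = 0
      \<and> psubst (coord_proj Y W) u = 0 \<and> psubst (coord_proj X Z) u = 0
    \<and> psubst (coord_proj Y Z) (u + v) = 0 \<and> psubst (coord_proj X W) (u + v) = 0"

lemma coord_vanish_add:
  assumes "coord_vanish u v" "coord_vanish u' v'"
  shows "coord_vanish (u + u') (v + v')"
proof -
  have "u + u' + (v + v') = (u + v) + (u' + v')" by simp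
  then show ?thesis
    using assms unfolding coord_vanish_def by (simp only: psubst.insertion_add) simp
qed

lemma psubst_coord_proj_decomp:
  obtains f1 f2 where "f = psubst (coord_proj c d) f + Var c * f1 + Var d * f2"
proof -
  have comp: "psubst (Var(d := 0)) (psubst (Var(c := 0)) f) = psubst (coord_proj c d) f"
    by (induction f rule: R_induct) auto
  obtain f1 where f1: "f - psubst (Var(c := 0)) f = Var c * f1"
    using diff_psubst_upd[of c 0 f] by (auto elim: dvdE)
  obtain f2 where f2: "psubst (Var(c := 0)) f - psubst (coord_proj c d) f = Var d * f2"
    using diff_psubst_upd[of d 0 "psubst (Var(c := 0)) f"] unfolding comp by (auto elim: dvdE)
  have "f = psubst (coord_proj c d) f + (f - psubst (Var(c := 0)) f) + (psubst (Var(c := 0)) f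
      - psubst (coord_proj c d) f)" by simp
  then show ?thesis using that unfolding f1 f2 by blast
qed

text \<open>The ideals (a, b) and (c, d) involve disjoint variables, so their intersection is their
  product.\<close>

lemma two_planes_decomp:
  assumes "distinct [a, b, c, d]" "psubst (coord_proj a b) f = 0" "psubst (coord_proj c d) f = 0"
  obtains f1 f2 f3 f4 where
    "f = Var a * Var c * f1 + Var a * Var d * f2 + Var b * Var c * f3 + Var b * Var d * f4"
proof -
  obtain g h where f: "f = Var c * g + Var d * h"
    using psubst_coord_proj_decomp[of f c d] assms(3) by auto
  obtain g1 g2 where g: "g = psubst (coord_proj a b) g + Var a * g1 + Var b * g2"
      by (rule psubst_coord_proj_decomp)
  obtain h1 h2 where h: "h = psubst (coord_proj a b) h + Var a * h1 + Var b * h2"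
      by (rule psubst_coord_proj_decomp)
  have "Var c * psubst (coord_proj a b) g + Var d * psubst (coord_proj a b) h
      = psubst (coord_proj a b) f"
    using assms(1) unfolding f by auto
  then have 0: "Var c * psubst (coord_proj a b) g + Var d * psubst (coord_proj a b) h
      = 0" using assms(2) by simp
  have "f = (Var c * psubst (coord_proj a b) g + Var d * psubst (coord_proj a b) h)
      + (Var a * Var c * g1 + Var a * Var d * h1 + Var b * Var c * g2 + Var b * Var d * h2)"
    by (subst f, subst g, subst h) (simp only: algebra_simps)
  then show ?thesis using that unfolding 0 by simp
qed

text \<open>Four conditions write u and v in terms of quadratic monomials. The monomials X W and Y Z
  occur in both, and the conditions on u + v bring their coefficients into a form that regroups into
  the generators.\<close>

lemma coord_vanish_imp_in_I3:
  assumes "coord_vanish u v"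
  shows "quad1 * u + quad2 * v \<in> I3"
proof -
  obtain u1 u2 u3 u4 where u: "u = Var Y * Var X * u1 + Var Y * Var Z * u2 + Var W * Var X * u3
      + Var W * Var Z * u4"
    by (rule two_planes_decomp[of Y W X Z u]) (use assms in \<open>auto simp: coord_vanish_def\<close>)
  obtain v1 v2 v3 v4 where v: "v = Var Z * Var X * v1 + Var Z * Var Y * v2 + Var W * Var X * v3
      + Var W * Var Y * v4"
    by (rule two_planes_decomp[of Z W X Y v]) (use assms in \<open>auto simp: coord_vanish_def\<close>)
  have "psubst (coord_proj Y Z) (u + v) = 0" "psubst (coord_proj X W) (u + v) = 0" using assms
      by (auto simp: coord_vanish_def)
  then have "Var W * Var X * psubst (coord_proj Y Z) (u3 + v3) = 0"
      "Var Y * Var Z * psubst (coord_proj X W) (u2 + v2) = 0"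
    unfolding u v by (simp_all add: algebra_simps)
  then have "psubst (coord_proj Y Z) (u3 + v3) = 0" "psubst (coord_proj X W) (u2 + v2) = 0" by auto
  then obtain e1 e2 e3 e4 where e: "u3 + v3 = Var Y * e1 + Var Z * e2" "u2 + v2 = Var X * e3
      + Var W * e4"
    using psubst_coord_proj_decomp[of "u3 + v3" Y Z] psubst_coord_proj_decomp[of "u2 + v2" X W]
        by (metis add_0)
  have v23: "v3 = Var Y * e1 + Var Z * e2 - u3" "v2 = Var X * e3 + Var W * e4 - u2"
    using e by (simp_all add: algebra_simps)
  have "quad1 * u + quad2 * v = I3_gen X Y Z W * u1 + I3_gen Z W X Y * u4 + I3_gen X Z Y W * (v1
      + Var W * e2 + Var Y * e3)
      + I3_gen Y W X Z * (v4 + Var X * e1 + Var Z * e4) - I3_gen X W Y Z * u3 - I3_gen Y Z X W * u2"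
    unfolding u v v23 quad1_def quad2_def I3_gen_def by (simp add: algebra_simps)
  moreover have "\<dots> \<in> I3"
    by (intro is_idealD(2,4,6)[OF is_ideal_I3] I3_gen_in_I3) auto
  ultimately show ?thesis by simp
qed

lemma in_I3_imp_coord_vanish:
  assumes "f \<in> I3"
  shows "\<exists>u v. f = quad1 * u + quad2 * v \<and> coord_vanish u v"
proof -
  let ?J = "{f. \<exists>u v. f = quad1 * u + quad2 * v \<and> coord_vanish u v}"
  have "I3 \<subseteq> ?J"
  proof (rule I3_subset)
    show "is_ideal ?J"
      unfolding is_ideal_def
    proof (intro conjI ballI allI)
      have "0 = quad1 * 0 + quad2 * 0 \<and> coord_vanish 0 0" by (simp add: coord_vanish_def)
      then show "0 \<in> ?J" by blast
    next
      fix f g assume "f \<in> ?J" "g \<in> ?J"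
      then obtain u v u' v' where "f = quad1 * u + quad2 * v" "g = quad1 * u' + quad2 * v'"
          "coord_vanish u v" "coord_vanish u' v'" by blast
      then have "f + g = quad1 * (u + u') + quad2 * (v + v') \<and> coord_vanish (u + u') (v + v')"
        using coord_vanish_add by (auto simp: algebra_simps)
      then show "f + g \<in> ?J" by blast
    next
      fix r f assume "f \<in> ?J"
      then obtain u v where "f = quad1 * u + quad2 * v" "coord_vanish u v" by blast
      then have "r * f = quad1 * (r * u) + quad2 * (r * v) \<and> coord_vanish (r * u) (r * v)"
        by (simp add: coord_vanish_def distrib_left mult.left_commute flip: distrib_left[of
            "psubst _ r"])
      then show "r * f \<in> ?J" by blast
    qed
    have J: "g \<in> ?J" if "g = quad1 * u + quad2 * v" "coord_vanish u v" for g u v using that by blast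
    show "I3_gen X Y Z W \<in> ?J" by (rule J[of _
        "Var X * Var Y" 0]) (auto simp: coord_vanish_def I3_gen_def quad1_def)
    show "I3_gen Z W X Y \<in> ?J" by (rule J[of _
        "Var Z * Var W" 0]) (auto simp: coord_vanish_def I3_gen_def quad1_def)
    show "I3_gen X Z Y W \<in> ?J" by (rule J[of _ 0
        "Var X * Var Z"]) (auto simp: coord_vanish_def I3_gen_def quad2_def)
    show "I3_gen Y W X Z \<in> ?J" by (rule J[of _ 0
        "Var Y * Var W"]) (auto simp: coord_vanish_def I3_gen_def quad2_def)
    show "I3_gen X W Y Z \<in> ?J"
      by (rule J[of _ "- (Var X * Var W)" "Var X * Var W"]) (auto simp: coord_vanish_def
          I3_gen_def quad1_def quad2_def algebra_simps)
    show "I3_gen Y Z X W \<in> ?J"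
      by (rule J[of _ "- (Var Y * Var Z)" "Var Y * Var Z"]) (auto simp: coord_vanish_def
          I3_gen_def quad1_def quad2_def algebra_simps)
  qed
  then show ?thesis using assms by blast
qed

lemma quad1_nonzero: "quad1 \<noteq> 0"
  by (simp add: quad1_def)

lemma quad1_dvd_cancel:
  assumes "quad1 dvd quad2 * v"
  shows "quad1 dvd v"
proof -
  have "cube_diff X Y dvd quad2 * v" using assms by (simp add: quad1_def dvd_mult_left)
  then have "cube_diff X Y dvd v"
    by (rule cube_diff_dvd_cancel[rotated]) (simp_all add: quad2_def power_mult_distrib
        Const_cube_root)
  then obtain k where k: "v = cube_diff X Y * k" by (rule dvdE)
  then have "cube_diff X Y * cube_diff Z W dvd cube_diff X Y * (quad2 * k)"
    using assms by (simp only: quad1_def mult_ac)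
  then have "cube_diff Z W dvd quad2 * k" unfolding dvd_mult_cancel_left by simp
  then have "cube_diff Z W dvd k"
    by (rule cube_diff_dvd_cancel[rotated]) (simp_all add: quad2_def power_mult_distrib
        Const_cube_root)
  then show ?thesis by (simp add: quad1_def k)
qed

text \<open>\<open>quad1\<close> and \<open>quad2\<close> are coprime, so only the Koszul relations
  occur.\<close>

lemma quad_syzygy:
  assumes "quad1 * u + quad2 * v = 0"
  obtains t where "u = quad2 * t" "v = - quad1 * t"
proof -
  have eq: "quad2 * v = quad1 * (- u)" using assms by (simp add: eq_neg_iff_add_eq_0 add.commute)
  then have "quad1 dvd v" using quad1_dvd_cancel by simp
  then obtain k where k: "v = quad1 * k" by (rule dvdE)
  then have "quad1 * (quad2 * k) = quad1 * (- u)" using eq by (simp add: mult_ac)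
  then have "quad2 * k = - u" using quad1_nonzero by (simp only: mult_cancel_left) simp
  then show ?thesis using k that[of "- k"] by simp
qed

text \<open>Two representations of one element differ by a Koszul relation, and such a relation
  satisfies \<open>coord_vanish\<close>; hence the criterion does not depend on the
  representation.\<close>

lemma in_I3_iff_coord_vanish: "quad1 * u + quad2 * v \<in> I3 \<longleftrightarrow> coord_vanish u v"
proof
  assume "quad1 * u + quad2 * v \<in> I3"
  then obtain u' v' where uv: "quad1 * u + quad2 * v = quad1 * u' + quad2 * v'" "coord_vanish u' v'"
    using in_I3_imp_coord_vanish by blast
  then have "quad1 * (u - u') + quad2 * (v - v') = 0" by (simp add: algebra_simps)
  then obtain t where "u - u' = quad2 * t" "v - v' = - quad1 * t" by (rule quad_syzygy)
  then have "u = u' + quad2 * t" "v = v' + - quad1 * t" by (simp_all add: diff_eq_eq add.commute)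
  moreover have "coord_vanish (quad2 * t) (- quad1 * t)"
      by (auto simp: coord_vanish_def quad1_def quad2_def algebra_simps)
  ultimately show "coord_vanish u v" using uv(2) coord_vanish_add[of u' v' "quad2 * t"
      "- quad1 * t"] by simp
qed (rule coord_vanish_imp_in_I3)

lemma Var_power_dvd_cancel:
  assumes "Var a ^ n dvd E * v" "psubst (Var(a := 0)) E \<noteq> 0"
  shows "Var a ^ n dvd v"
  using assms(1)
proof (induction n arbitrary: v)
  case (Suc n)
  then obtain k where k: "E * v = Var a ^ Suc n * k" by (auto elim: dvdE)
  then have "psubst (Var(a := 0)) (E * v) = 0" by simp
  then have "psubst (Var(a := 0)) v = 0" using assms(2) by simp
  then obtain v' where v': "v = Var a * v'" using dvd_of_psubst_upd_eq_0[of a 0 v]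
      by (auto elim: dvdE)
  then have "Var a * (E * v') = Var a * (Var a ^ n * k)" using k by (simp add: mult_ac)
  then have "E * v' = Var a ^ n * k" by (simp only: mult_cancel_left) simp
  then have "Var a ^ n dvd v'" using Suc.IH by simp
  then show ?case by (simp add: v')
qed simp

text \<open>The variable p is a nonzerodivisor modulo (\<open>quad1\<close>, \<open>quad2\<close>):
  at p = 0 the two forms remain coprime, so u' and v' reduce to a multiple of their Koszul relation.
  Subtracting the lifted relation leaves coefficients divisible by p.\<close>

lemma Var_nonzerodivisor_quad:
  assumes pqrs: "distinct [p, q, r, s]" and quad1_eq: "quad1
      = cube_diff p q * cube_diff r s" and quad2_eq: "quad2 = cube_diff p r * cube_diff q s"
    and eq: "Var p * h = quad1 * u' + quad2 * v'"
  obtains u v where "h = quad1 * u + quad2 * v"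
proof -
  let ?z = "psubst (Var(p := 0))"
  have zA: "?z quad1 = - (Var q ^ 3 * cube_diff r s)" and zB: "?z quad2 =
      - (Var r ^ 3 * cube_diff q s)"
    using pqrs by (auto simp: quad1_eq quad2_eq)
  have "?z (Var p * h) = ?z (quad1 * u' + quad2 * v')" by (simp only: eq)
  then have e0: "?z quad1 * ?z u' + ?z quad2 * ?z v' = 0" by simp
  then have e: "?z quad2 * ?z v' = Var q ^ 3 * (cube_diff r s * ?z u')"
    unfolding zA by (simp add: algebra_simps)
  have "Var q ^ 3 dvd ?z v'"
    by (rule Var_power_dvd_cancel[of q 3 "?z quad2"]) (use e pqrs in \<open>auto simp: zB\<close>)
  then obtain k where k: "?z v' = Var q ^ 3 * k" by (rule dvdE)
  have "Var q ^ 3 * (?z quad2 * k) = Var q ^ 3 * (cube_diff r s * ?z u')" using e k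
      by (simp only: mult_ac)
  then have e2: "?z quad2 * k = cube_diff r s * ?z u'" by (simp only: mult_cancel_left) simp
  have "cube_diff r s dvd k"
  proof (rule cube_diff_dvd_cancel[of r s "?z quad2"])
    fix w :: complex assume "w ^ 3 = 1"
    then show "psubst (Var(r := Const w * Var s)) (?z quad2) \<noteq> 0"
      using pqrs by (auto simp: zB power_mult_distrib Const_cube_root)
  qed (use pqrs e2 in auto)
  then obtain l where l: "k = cube_diff r s * l" by (rule dvdE)
  have v0: "?z v' = - (?z quad1 * l)" unfolding zA k l by (simp add: mult_ac)
  have "?z quad1 \<noteq> 0" using pqrs by (simp add: zA)
  moreover have "?z quad1 * (?z u') = ?z quad1 * (?z quad2 * l)"
    using e0 unfolding v0 by (simp add: algebra_simps)
  ultimately have u0: "?z u' = ?z quad2 * l" by simp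
  have d: "Var p dvd f - ?z f" for f using diff_psubst_upd[of p 0 f] by simp
  have "u' - quad2 * l = (u' - ?z u') - (quad2 - ?z quad2) * l" unfolding u0
      by (simp add: algebra_simps)
  then have "Var p dvd u' - quad2 * l" using dvd_diff[OF d[of u'] dvd_mult2[OF d[of quad2]]]
      by metis
  then obtain u where u: "u' - quad2 * l = Var p * u" by (rule dvdE)
  have "v' + quad1 * l = (v' - ?z v') + (quad1 - ?z quad1) * l" unfolding v0
      by (simp add: algebra_simps)
  then have "Var p dvd v' + quad1 * l" using dvd_add[OF d[of v'] dvd_mult2[OF d[of quad1]]] by metis
  then obtain v where v: "v' + quad1 * l = Var p * v" by (rule dvdE)
  have "Var p * h = quad1 * (u' - quad2 * l) + quad2 * (v' + quad1 * l)" unfolding eq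
      by (simp add: algebra_simps)
  also have "\<dots> = Var p * (quad1 * u + quad2 * v)" unfolding u v by (simp add: algebra_simps)
  finally have "h = quad1 * u + quad2 * v" by simp
  then show ?thesis by (rule that)
qed

text \<open>One variable other than d, being a nonzerodivisor, puts h into (\<open>quad1\<close>,
  \<open>quad2\<close>). Each coordinate plane then leaves two variables nonzero, at least one of
  them different from d, and that one cancels from the vanishing condition.\<close>

lemma I3_saturated:
  assumes h: "\<And>v. v \<noteq> d \<Longrightarrow> Var v * h \<in> I3"
  shows "h \<in> I3"
proof -
  have "\<exists>u v. h = quad1 * u + quad2 * v"
  proof (cases "d = X")
    case False
    then obtain u v where "Var X * h = quad1 * u
        + quad2 * v" using in_I3_imp_coord_vanish[OF h, of X] by blast
    then show ?thesis
      by (rule Var_nonzerodivisor_quad[of X Y Z W, rotated 3]) (auto simp: quad1_def quad2_def)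
  next
    case True
    then obtain u v where "Var Y * h = quad1 * u
        + quad2 * v" using in_I3_imp_coord_vanish[OF h, of Y] by blast
    then show ?thesis
      by (rule Var_nonzerodivisor_quad[of Y X W Z, rotated 3]) (auto simp: quad1_def quad2_def
          algebra_simps)
  qed
  then obtain u v where uv: "h = quad1 * u + quad2 * v" by blast
  have "coord_vanish (Var x * u) (Var x * v)" if "x \<noteq> d" for x
  proof -
    have "quad1 * (Var x * u) + quad2 * (Var x * v) \<in> I3" using h[OF that]
        by (simp add: uv algebra_simps)
    then show ?thesis by (simp only: in_I3_iff_coord_vanish)
  qed
  then have x: "psubst (coord_proj Z W) (Var x) * psubst (coord_proj Z W) v = 0
      \<and> psubst (coord_proj X Y) (Var x) * psubst (coord_proj X Y) v = 0
      \<and> psubst (coord_proj Y W) (Var x) * psubst (coord_proj Y W) u = 0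
          \<and> psubst (coord_proj X Z) (Var x) * psubst (coord_proj X Z) u = 0
      \<and> psubst (coord_proj Y Z) (Var x) * psubst (coord_proj Y Z) (u + v) = 0
          \<and> psubst (coord_proj X W) (Var x) * psubst (coord_proj X W) (u + v) = 0"
    if "x \<noteq> d" for x
    using that unfolding coord_vanish_def by (simp only: psubst.insertion_mult
        psubst.insertion_add distrib_left) blast
  have "coord_vanish u v"
    unfolding coord_vanish_def using x[of X] x[of Y] x[of Z] x[of W] by (cases d) simp_all
  then show ?thesis unfolding uv by (rule coord_vanish_imp_in_I3)
qed

section \<open>Membership of \<open>fermat\<close> in the cube of \<open>I3\<close>, locally at the
  associated primes\<close>

lemma cube_diff_product_eq_fermat:
  assumes "distinct [a, b, c, d]"
  shows "fermat = cube_diff a b * cube_diff c d * cube_diff a c * cube_diff b d * cube_diff b c *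
      cube_diff a d
    \<or> fermat = - (cube_diff a b * cube_diff c d * cube_diff a c * cube_diff b d * cube_diff b c *
        cube_diff a d)"
proof -
  have swap: "cube_diff Y X = - cube_diff X Y" "cube_diff Z X = - cube_diff X Z" "cube_diff W X =
      - cube_diff X W"
    "cube_diff Z Y = - cube_diff Y Z" "cube_diff W Y = - cube_diff Y W" "cube_diff W Z =
        - cube_diff Z W"
    by simp_all
  define x y z w p q where "x = cube_diff X Y" "y = cube_diff X Z" "z = cube_diff X W" "w
      = cube_diff Y Z" "p = cube_diff Y W" "q = cube_diff Z W"
  note defs = this[symmetric]
  show ?thesis
    using assms
    by (cases a; cases b; cases c; cases d; simp only: distinct.simps list.set insert_iff empty_iff
        var.distinct var.distinct[symmetric] refl simp_thms;
        simp only: fermat_def swap defs mult_minus_left mult_minus_right minus_minus mult_ac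
            simp_thms)
qed

lemma fermat_in_ideal_power:
  assumes "distinct [a, b, c, d]" "t * (cube_diff a b * cube_diff c d * cube_diff a c * cube_diff
      b d * cube_diff b c * cube_diff a d) \<in> ideal_power I3 3"
  shows "t * fermat \<in> ideal_power I3 3"
proof -
  define Q where "Q = cube_diff a b * cube_diff c d * cube_diff a c * cube_diff b d * cube_diff b
      c * cube_diff a d"
  have "fermat = Q \<or> fermat = - Q" using cube_diff_product_eq_fermat[OF assms(1)]
      by (simp only: Q_def)
  moreover have "t * Q \<in> ideal_power I3 3" using assms(2) by (simp only: Q_def)
  moreover from this have "t * - Q \<in> ideal_power I3 3"
    using is_idealD(5)[OF is_ideal_ideal_power] by (simp only: mult_minus_right)
  ultimately show ?thesis by (elim disjE) (simp_all only:)
qed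

lemma ideal_power_3: "a \<in> I \<Longrightarrow> b \<in> I \<Longrightarrow> c \<in> I \<Longrightarrow> a * b * c \<in> ideal_power I 3"
  using prod_list_in_ideal_power[of "[a, b, c]" 3 I] by (simp add: mult.assoc)

lemma fermat_locally_in_cube:
  assumes "P \<in> Ass I3"
  shows "\<exists>t. t \<notin> P \<and> t * fermat \<in> ideal_power I3 3"
proof (rule ccontr)
  assume "\<not> ?thesis"
  then have J: "t \<in> P" if "t * fermat \<in> ideal_power I3 3" for t using that by blast
  obtain h where P: "is_prime_ideal P" and h: "P = ideal_colon I3 h"
    using assms by (auto simp: Ass_def)
  have prime: "a * b \<in> P \<Longrightarrow> a \<in> P \<or> b \<in> P" for a b using P by (simp add: is_prime_ideal_def)
  have "is_ideal P" using P by (simp add: is_prime_ideal_def)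
  note idP = is_idealD[OF this]
  have triple: "Var a \<in> P \<or> Var b \<in> P \<or> Var c \<in> P" if abc: "distinct [a, b, c]" for a b c
  proof -
    obtain d where d: "distinct [a, b, c, d]" using abc by (rule obtain_vars3)
    \<comment> \<open>In this product every difference of cubes occurs exactly once, up to
      sign.\<close>
    have "I3_gen a b c d * I3_gen a c b d * I3_gen b c a d \<in> ideal_power I3 3"
      using d by (intro ideal_power_3 I3_gen_in_I3) auto
    then have "(Var a ^ 2 * Var b ^ 2 * Var c ^ 2)
        * (cube_diff a b * cube_diff c d * cube_diff a c * cube_diff b d * cube_diff b c *
            cube_diff a d) \<in> ideal_power I3 3"
      by (simp add: I3_gen_def power2_eq_square mult_ac)
    then have "Var a ^ 2 * Var b ^ 2 * Var c ^ 2 \<in> P" by (intro J fermat_in_ideal_power[OF d])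
    then show ?thesis using prime prime_ideal_power[OF P] by blast
  qed
  have pair: "Var c \<in> P \<or> Var d \<in> P" if "c \<noteq> d" for c d
  proof (rule ccontr)
    assume n: "\<not> ?thesis"
    obtain a b where "distinct [c, d, a, b]" using \<open>c \<noteq> d\<close> by (rule obtain_vars2)
    then have abcd: "distinct [a, b, c, d]" by auto
    then have ab: "Var a \<in> P" "Var b \<in> P" using triple[of a c d] triple[of b c d] n by auto
    define D where "D = cube_diff a c * cube_diff b d"
    \<comment> \<open>The generators are D a c and D b d; combining their cubes produces the missing
      factor a^3 - b^3.\<close>
    have "I3_gen a c b d * I3_gen a c b d * I3_gen a c b d * Var d ^ 3
        - I3_gen b d a c * I3_gen b d a c * I3_gen b d a c * Var c ^ 3
        \<in> ideal_power I3 3"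
      using abcd by (intro is_idealD(4,6)[OF is_ideal_ideal_power] ideal_power_3 I3_gen_in_I3) auto
    also have "I3_gen a c b d * I3_gen a c b d * I3_gen a c b d * Var d ^ 3
        - I3_gen b d a c * I3_gen b d a c * I3_gen b d a c * Var c ^ 3
        = Var c ^ 3 * Var d ^ 3 * D ^ 3 * cube_diff a b"
      by (simp add: I3_gen_def D_def power3_eq_cube algebra_simps)
    finally have "Var c ^ 3 * Var d ^ 3 * D ^ 3 * cube_diff a b * (cube_diff c d * cube_diff b c *
        cube_diff a d) \<in> ideal_power I3 3"
      by (rule is_idealD(4)[OF is_ideal_ideal_power])
    then have "(Var c ^ 3 * Var d ^ 3 * D ^ 2)
        * (cube_diff a b * cube_diff c d * cube_diff a c * cube_diff b d * cube_diff b c *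
            cube_diff a d) \<in> ideal_power I3 3"
      by (simp add: D_def power2_eq_square power3_eq_cube mult_ac)
    then have "Var c ^ 3 * Var d ^ 3 * D ^ 2 \<in> P" by (intro J fermat_in_ideal_power[OF abcd])
    then have "D ^ 2 \<in> P"
      using n prime[of "Var c ^ 3 * Var d ^ 3" "D ^ 2"] prime[of "Var c ^ 3" "Var d ^ 3"]
        prime_ideal_power[OF P, of "Var c" 3] prime_ideal_power[OF P, of "Var d" 3] by auto
    then have "cube_diff a c \<in> P \<or> cube_diff b d \<in> P"
      using prime[of "cube_diff a c" "cube_diff b d"] prime_ideal_power[OF P, of D 2] unfolding
          D_def by auto
    moreover have "Var v ^ 3 \<in> P" if "Var u \<in> P" "cube_diff u v \<in> P" for u v
    proof -
      have "Var u * Var u ^ 2 - cube_diff u v \<in> P" by (intro idP(4,6) that)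
      then show ?thesis by (simp add: power2_eq_square power3_eq_cube mult_ac)
    qed
    \<comment> \<open>Since a and b lie in P, a^3 - c^3 in P gives c^3 in P, and b^3 - d^3 in P
      gives d^3 in P.\<close>
    ultimately have "Var c ^ 3 \<in> P \<or> Var d ^ 3 \<in> P" using ab by auto
    then show False
      using n prime_ideal_power[OF P, of "Var c" 3] prime_ideal_power[OF P, of "Var d" 3] by auto
  qed
  \<comment> \<open>No two variables are both outside P, so at most one is.\<close>
  have "\<exists>d. \<forall>v. v \<noteq> d \<longrightarrow> Var v \<in> P" using pair by metis
  then obtain d where "\<forall>v. v \<noteq> d \<longrightarrow> Var v \<in> P" ..
  then have "Var v * h \<in> I3" if "v \<noteq> d" for v using that by (simp add: h ideal_colon_def)
  then have "h \<in> I3" by (rule I3_saturated)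
  then have "r \<in> P" for r using is_idealD(3)[OF is_ideal_I3, of h r]
      by (simp add: h ideal_colon_def)
  then show False using P by (auto simp: is_prime_ideal_def)
qed

lemma alpha_symbolic_power_I3:
  assumes "j \<le> 2"
  shows "alpha (symbolic_power I3 (3 * m + j)) = 18 * m + 8 * j"
  unfolding alpha_def
proof (rule Least_equality)
  define g where "g = I3_gen X Y Z W"
  have g: "g \<in> I3" unfolding g_def by (rule I3_gen_in_I3) simp
  have "fermat ^ m * g ^ j \<in> symbolic_power I3 (3 * m + j)"
    unfolding symbolic_power_def loc_contract_def
  proof (intro INT_I CollectI)
    fix P assume PA: "P \<in> Ass I3"
    then have P: "is_prime_ideal P" by (simp add: Ass_def)
    obtain t where t: "t \<notin> P" "t * fermat \<in> ideal_power I3 3" using fermat_locally_in_cube[OF PA]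
        by blast
    \<comment> \<open>The multiplier for the localization is t^m, which stays outside the prime
      P.\<close>
    have "(t * fermat) ^ m * g ^ j \<in> ideal_power I3 (3 * m + 1 * j)"
      by (intro ideal_power_mult ideal_power_power t ideal_power_1 g)
    then have "t ^ m * (fermat ^ m * g ^ j) \<in> ideal_power I3 (3 * m + j)"
      by (simp add: power_mult_distrib mult_ac)
    then show "\<exists>s. s \<notin> P \<and> s * (fermat ^ m * g ^ j) \<in> ideal_power I3 (3 * m + j)"
      using t(1) prime_ideal_power[OF P] by blast
  qed
  moreover have "fermat ^ m * g ^ j \<noteq> 0" using fermat_nonzero by (simp add: g_def I3_gen_def)
  moreover have "homogeneous_of_degree (18 * m + 8 * j) (fermat ^ m * g ^ j)"
    unfolding g_def by (intro homogeneous_mult homogeneous_power homogeneous_fermat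
        homogeneous_I3_gen)
  ultimately show "\<exists>f\<in>symbolic_power I3 (3 * m + j). f \<noteq> 0 \<and> homogeneous_of_degree (18 * m
      + 8 * j) f"
    by blast
next
  fix d assume "\<exists>f\<in>symbolic_power I3 (3 * m + j). f \<noteq> 0 \<and> homogeneous_of_degree d f"
  then show "18 * m + 8 * j \<le> d"
    using degree_lower_bound vanishes_symbolic_power assms by blast
qed

theorem theorem3p4:
  shows "(\<forall>m::nat. m \<ge> 1 \<longrightarrow> alpha (symbolic_power I3 (3*m)) = 18*m)
       \<and> (\<forall>m::nat. alpha (symbolic_power I3 (3*m+1)) = 18*m+8)
       \<and> (\<forall>m::nat. alpha (symbolic_power I3 (3*m+2)) = 18*m+16)"
  using alpha_symbolic_power_I3[of 0] alpha_symbolic_power_I3[of 1] alpha_symbolic_power_I3[of 2]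
  by simp

end
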